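(* Let $k$ be a positive integer and $a\in\mathbb{R}$, and consider the planar system $$\dot u=-v+u\left((u^2+v^2)^{-k}+a\right),\qquad \dot v=u+v\left((u^2+v^2)^{-k}+a\right)$$ (or equivalently, outside the origin, its polynomial version obtained by multiplying the right-hand sides by $(u^2+v^2)^k$). If $a=0$, then every unbounded spiral trajectory $\Gamma$ of the system lying at positive distance from the origin satisfies $$\dim_B\Gamma=\frac{4k}{2k+1},$$ and $\Gamma$ is Minkowski measurable. For all other values $a\neq0$, the box dimension of such trajectories is trivial, i.e. equal to $1$.
   Context: This system is the geometric inversion $u=x/(x^2+y^2)$, $v=y/(x^2+y^2)$ of the Hopf normal form $\dot x=-y-x((x^2+y^2)^k+a)$, $\dot y=x-y((x^2+y^2)^k+a)$. For a nonempty bounded $B\subset\mathbb{R}^2$, with $B_\varepsilon$ its $\varepsilon$-neighbourhood and $|B_\varepsilon|$ its area, $\mathcal M^{*s}(B)=\limsup_{\varepsilon\to0}|B_\varepsilon|/\varepsilon^{2-s}$, $\mathcal M_*^s(B)$ the same with $\liminf$, $\overline{\dim}_BB=\inf\{s:\mathcal M^{*s}(B)=0\}$, $\underline{\dim}_BB=\inf\{s:\mathcal M_*^{s}(B)=0\}$, $\dim_BB$ their common value; $B$ is Minkowski measurable if $\mathcal M_*^d(B)=\mathcal M^{*d}(B)\in(0,\infty)$ for $d=\dim_BB$. For unbounded $A\subset\mathbb{R}^2$ with $0\notin\overline A$, these notions are defined via the bounded set $\Phi(A)$, $\Phi(x)=x/|x|^2$. *)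

theory Defs
  imports "HOL-Analysis.Analysis"
begin

definition hopf_inv_field :: "nat \<Rightarrow> real \<Rightarrow> real \<times> real \<Rightarrow> real \<times> real" where
  "hopf_inv_field k a p =
     (let u = fst p; v = snd p; w = 1 / (u\<^sup>2 + v\<^sup>2) ^ k + a
      in (- v + u * w, u + v * w))"

definition eps_nbhd :: "(real \<times> real) set \<Rightarrow> real \<Rightarrow> (real \<times> real) set" where
  "eps_nbhd B e = {x. \<exists>b\<in>B. dist x b < e}"

definition upper_mink_content :: "real \<Rightarrow> (real \<times> real) set \<Rightarrow> ereal" where
  "upper_mink_content s B =
     Limsup (at_right 0) (\<lambda>e. ereal (measure lborel (eps_nbhd B e) / e powr (2 - s)))"

definition lower_mink_content :: "real \<Rightarrow> (real \<times> real) set \<Rightarrow> ereal" where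
  "lower_mink_content s B =
     Liminf (at_right 0) (\<lambda>e. ereal (measure lborel (eps_nbhd B e) / e powr (2 - s)))"

definition upper_box_dim :: "(real \<times> real) set \<Rightarrow> real" where
  "upper_box_dim B = Inf {s. upper_mink_content s B = 0}"

definition lower_box_dim :: "(real \<times> real) set \<Rightarrow> real" where
  "lower_box_dim B = Inf {s. lower_mink_content s B = 0}"

definition minkowski_measurable :: "(real \<times> real) set \<Rightarrow> bool" where
  "minkowski_measurable B \<longleftrightarrow>
     (let d = upper_box_dim B in
        lower_box_dim B = d \<and>
        lower_mink_content d B = upper_mink_content d B \<and>
        0 < upper_mink_content d B \<and> upper_mink_content d B < \<infinity>)"

definition inversion :: "real \<times> real \<Rightarrow> real \<times> real" where
  "inversion x = (1 / (norm x)\<^sup>2) *\<^sub>R x"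

text \<open>Notions for unbounded sets A (with 0 not in the closure of A), defined via \<open>\<Phi>(A)\<close>.\<close>
definition upper_box_dim_inf :: "(real \<times> real) set \<Rightarrow> real" where
  "upper_box_dim_inf A = upper_box_dim (inversion ` A)"

definition lower_box_dim_inf :: "(real \<times> real) set \<Rightarrow> real" where
  "lower_box_dim_inf A = lower_box_dim (inversion ` A)"

definition minkowski_measurable_inf :: "(real \<times> real) set \<Rightarrow> bool" where
  "minkowski_measurable_inf A = minkowski_measurable (inversion ` A)"

end

theory Submission
  imports Defs
begin

text \<open>
  In polar coordinates the inverted orbit is \<open>\<rho>(t) exp (i (t + \<theta>0))\<close>, and \<open>q = \<rho>\<^bsup>-2k\<^esup>\<close>
  satisfies the linear equation \<open>q' = 2k (1 + a q)\<close>.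

  For \<open>a = 0\<close> we have \<open>q = 2kt + c\<close>. The circle of radius \<open>r\<close> meets the \<open>\<epsilon>\<close>-neighbourhood in an arc which, up to an
  error \<open>O(\<epsilon>/r)\<close>, has length \<open>min (2\<pi>) (((r-\<epsilon>)\<^bsup>-2k\<^esup> - (r+\<epsilon>)\<^bsup>-2k\<^esup>) / 2k)\<close>, because the times \<open>t\<close> with
  \<open>|\<rho>(t) - r| < \<epsilon>\<close> form an interval and time is the angle. Integrating \<open>r\<close> times this quantity,
  the area is \<open>\<pi>\<sigma>\<^sup>2 (2k+1)/(2k-1) (1 + o(1))\<close>, where \<open>\<epsilon> = \<pi>\<sigma>\<^bsup>2k+1\<^esup>\<close> determines the radius \<open>\<sigma>\<close> below which
  consecutive coils overlap.

  For \<open>a \<noteq> 0\<close> the quantity \<open>1 + aq\<close> is a multiple of \<open>exp (2kat)\<close>, so all but a time interval of length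
  \<open>O(log (1/\<epsilon>))\<close> is spent \<open>O(\<epsilon>)\<close>-close to the origin or to the limit cycle, and the area is \<open>O(\<epsilon> log (1/\<epsilon>))\<close>.
\<close>

section \<open>Area in polar coordinates\<close>

definition polar :: "real \<Rightarrow> real \<Rightarrow> real \<times> real" where
  "polar r \<theta> = (r * cos \<theta>, r * sin \<theta>)"

section \<open>Invariance of Lebesgue measure under shifts, shears and rotations\<close>

lemma emeasure_lborel_translate:
  fixes A :: "real set"
  assumes "A \<in> sets borel"
  shows "emeasure lborel {x. x + c \<in> A} = emeasure lborel A"
proof -
  have "emeasure lborel A = emeasure (distr lborel borel ((+) c)) A"
    by (simp add: lborel_distr_plus)
  also have "\<dots> = emeasure lborel ((+) c -` A)"
    using assms by (subst emeasure_distr) auto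
  also have "(+) c -` A = {x. x + c \<in> A}"
    by (auto simp: add.commute)
  finally show ?thesis by simp
qed

text \<open>A shift by a multiple of \<open>L\<close> brings the left end point to some
  \<open>b\<close> in \<open>{0..<L}\<close>. The piece beyond \<open>L\<close> is then moved back
  by one period, where it fills the gap below \<open>b\<close>.\<close>

lemma emeasure_periodic_interval:
  fixes P :: "real set" and L a :: real
  assumes P: "P \<in> sets borel" and per: "\<And>x. x + L \<in> P \<longleftrightarrow> x \<in> P" and L: "L > 0"
  shows "emeasure lborel (P \<inter> {a..<a+L}) = emeasure lborel (P \<inter> {0..<L})"
proof -
  note [measurable] = P
  have pern: "x + real n * L \<in> P \<longleftrightarrow> x \<in> P" for x n
  proof (induction n)
    case (Suc n)
    have "x + real (Suc n) * L = (x + real n * L) + L" by (simp add: algebra_simps)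
    then show ?case using per[of "x + real n * L"] Suc by (simp only:)
  qed simp
  have peri: "x + of_int n * L \<in> P \<longleftrightarrow> x \<in> P" for x n
  proof (cases "n \<ge> 0")
    case True
    then show ?thesis using pern[of x "nat n"] by simp
  next
    case False
    then show ?thesis using pern[of "x + of_int n * L" "nat (-n)"] by simp
  qed
  define n where "n = \<lfloor>a / L\<rfloor>"
  define b where "b = a - of_int n * L"
  have "of_int n \<le> a / L" "a / L < of_int n + 1"
    unfolding n_def by linarith+
  then have b: "0 \<le> b" "b < L"
    unfolding b_def using L by (simp_all add: field_simps)
  have "emeasure lborel (P \<inter> {a..<a+L}) = emeasure lborel {x. x + of_int n * L \<in> P \<inter> {a..<a+L}}"
    by (rule emeasure_lborel_translate[symmetric]) simp
  also have "{x. x + of_int n * L \<in> P \<inter> {a..<a+L}} = P \<inter> {b..<b+L}"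
    using peri by (auto simp: b_def)
  also have "\<dots> = (P \<inter> {b..<L}) \<union> (P \<inter> {L..<b+L})"
    using b by auto
  also have "emeasure lborel \<dots> = emeasure lborel (P \<inter> {b..<L}) + emeasure lborel (P \<inter> {L..<b+L})"
    by (rule plus_emeasure[symmetric]) auto
  also have "emeasure lborel (P \<inter> {L..<b+L}) = emeasure lborel {x. x + L \<in> P \<inter> {L..<b+L}}"
    by (rule emeasure_lborel_translate[symmetric]) simp
  also have "{x. x + L \<in> P \<inter> {L..<b+L}} = P \<inter> {0..<b}"
    using per by auto
  also have "emeasure lborel (P \<inter> {b..<L}) + emeasure lborel (P \<inter> {0..<b}) =
      emeasure lborel ((P \<inter> {b..<L}) \<union> (P \<inter> {0..<b}))"
    by (rule plus_emeasure) auto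
  also have "(P \<inter> {b..<L}) \<union> (P \<inter> {0..<b}) = P \<inter> {0..<L}"
    using b by auto
  finally show ?thesis .
qed

text \<open>By Fubini a shear acts on each horizontal line as a translation, which preserves
  length.\<close>

lemma nn_integral_shear_fst:
  fixes f :: "real \<times> real \<Rightarrow> ennreal"
  assumes [measurable]: "f \<in> borel_measurable borel"
  shows "(\<integral>\<^sup>+p. f (fst p + c * snd p, snd p) \<partial>lborel) = (\<integral>\<^sup>+p. f p \<partial>lborel)"
proof -
  have [measurable]: "f \<in> borel_measurable (lborel \<Otimes>\<^sub>M lborel)"
    using assms by (simp add: borel_prod lborel_prod)
  have *: "(\<integral>\<^sup>+x. f (x + c * y, y) \<partial>lborel) = (\<integral>\<^sup>+x. f (x, y) \<partial>lborel)" for y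
    using nn_integral_real_affine[of "\<lambda>x. f (x, y)" 1 "c * y"] by (simp add: add.commute)
  have "(\<integral>\<^sup>+p. f (fst p + c * snd p, snd p) \<partial>(lborel \<Otimes>\<^sub>M lborel))
      = (\<integral>\<^sup>+y. (\<integral>\<^sup>+x. f (x + c * y, y) \<partial>lborel) \<partial>lborel)"
    by (subst lborel_pair.nn_integral_snd[symmetric]) (simp_all add: borel_prod)
  also have "\<dots> = (\<integral>\<^sup>+p. f p \<partial>(lborel \<Otimes>\<^sub>M lborel))"
    unfolding * by (subst lborel_pair.nn_integral_snd[symmetric]) (simp_all add: borel_prod)
  finally show ?thesis by (simp add: lborel_prod)
qed

lemma nn_integral_shear_snd:
  fixes f :: "real \<times> real \<Rightarrow> ennreal"
  assumes [measurable]: "f \<in> borel_measurable borel"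
  shows "(\<integral>\<^sup>+p. f (fst p, snd p + c * fst p) \<partial>lborel) = (\<integral>\<^sup>+p. f p \<partial>lborel)"
proof -
  have [measurable]: "f \<in> borel_measurable (lborel \<Otimes>\<^sub>M lborel)"
    using assms by (simp add: borel_prod lborel_prod)
  have *: "(\<integral>\<^sup>+y. f (x, y + c * x) \<partial>lborel) = (\<integral>\<^sup>+y. f (x, y) \<partial>lborel)" for x
    using nn_integral_real_affine[of "\<lambda>y. f (x, y)" 1 "c * x"] by (simp add: add.commute)
  have "(\<integral>\<^sup>+p. f (fst p, snd p + c * fst p) \<partial>(lborel \<Otimes>\<^sub>M lborel))
      = (\<integral>\<^sup>+x. (\<integral>\<^sup>+y. f (x, y + c * x) \<partial>lborel) \<partial>lborel)"
    by (subst lborel.nn_integral_fst[symmetric]) (simp_all add: borel_prod)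
  also have "\<dots> = (\<integral>\<^sup>+p. f p \<partial>(lborel \<Otimes>\<^sub>M lborel))"
    unfolding * by (subst lborel.nn_integral_fst[symmetric]) (simp_all add: borel_prod)
  finally show ?thesis by (simp add: lborel_prod)
qed

definition rotate_plane :: "real \<Rightarrow> real \<times> real \<Rightarrow> real \<times> real" where
  "rotate_plane \<theta> p = (fst p * cos \<theta> - snd p * sin \<theta>, fst p * sin \<theta> + snd p * cos \<theta>)"

lemma rotate_plane_polar: "rotate_plane \<theta> (polar r \<tau>) = polar r (\<theta> + \<tau>)"
  by (simp add: rotate_plane_def polar_def cos_add sin_add algebra_simps)

text \<open>A rotation by an angle other than \<open>\<pi>\<close> is a product of three shears with slopes
  \<open>-tan (\<theta>/2)\<close>, \<open>sin \<theta>\<close>, \<open>-tan (\<theta>/2)\<close>.\<close>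

lemma nn_integral_rotate_plane:
  fixes f :: "real \<times> real \<Rightarrow> ennreal"
  assumes [measurable]: "f \<in> borel_measurable borel" and c: "cos \<theta> \<noteq> -1"
  shows "(\<integral>\<^sup>+p. f (rotate_plane \<theta> p) \<partial>lborel) = (\<integral>\<^sup>+p. f p \<partial>lborel)"
proof -
  define s where "s = - (sin \<theta> / (1 + cos \<theta>))"
  have nz: "1 + cos \<theta> \<noteq> 0" using c by linarith
  have "(sin \<theta>)\<^sup>2 = (1 - cos \<theta>) * (1 + cos \<theta>)"
    by (simp add: sin_squared_eq algebra_simps power2_eq_square)
  then have s1: "s * sin \<theta> = cos \<theta> - 1"
    unfolding s_def using nz by (simp add: field_simps power2_eq_square)
  have s2: "s * cos \<theta> + s = - sin \<theta>"
  proof -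
    have "s * (1 + cos \<theta>) = - sin \<theta>" unfolding s_def using nz by simp
    then show ?thesis by (simp add: algebra_simps)
  qed
  define f1 where "f1 = (\<lambda>p. f (fst p + s * snd p, snd p))"
  define f2 where "f2 = (\<lambda>p. f1 (fst p, snd p + sin \<theta> * fst p))"
  have [measurable]: "f1 \<in> borel_measurable borel" unfolding f1_def
    by (rule measurable_compose[OF borel_measurable_continuous_onI]) (auto intro!: continuous_intros)
  have [measurable]: "f2 \<in> borel_measurable borel" unfolding f2_def
    by (rule measurable_compose[OF borel_measurable_continuous_onI]) (auto intro!: continuous_intros)
  have rot: "f (rotate_plane \<theta> p) = f2 (fst p + s * snd p, snd p)" for p
  proof -
    obtain x y where p: "p = (x, y)" by (cases p)
    have a: "y + sin \<theta> * (x + s * y) = x * sin \<theta> + y * cos \<theta>"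
      using arg_cong[OF s1, of "\<lambda>u. y * u"] by (simp add: algebra_simps)
    have "x + s * y + s * (x * sin \<theta> + y * cos \<theta>) = x + x * (s * sin \<theta>) + y * (s * cos \<theta> + s)"
      by (simp add: algebra_simps)
    also have "\<dots> = x * cos \<theta> - y * sin \<theta>"
      unfolding s1 s2 by (simp add: algebra_simps)
    finally show ?thesis
      by (simp add: f2_def f1_def rotate_plane_def p a)
  qed
  show ?thesis
    unfolding rot nn_integral_shear_fst[of f2 s, simplified]
    using nn_integral_shear_snd[of f1 "sin \<theta>"] nn_integral_shear_fst[of f s]
    by (simp add: f2_def[symmetric] f1_def[symmetric])
qed

section \<open>Distribution of the norm and the polar area formula\<close>

text \<open>The half-lines \<open>{..<a}\<close> form an intersection-stable generator of the Borel
  sets, and on each of them both measures give the area \<open>pi * a^2\<close> of a disc. The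
  radial density thus follows from disc areas alone, with no change of variables.\<close>

lemma distr_norm_plane:
  "distr lborel borel (norm :: real \<times> real \<Rightarrow> real) =
     density lborel (\<lambda>r. ennreal (if 0 \<le> r then 2 * pi * r else 0))"
  (is "?M = ?N")
proof (rule measure_eqI_generator_eq[where E = "range lessThan" and \<Omega> = UNIV and A = "\<lambda>n. {..<real n}"])
  show "Int_stable (range lessThan :: real set set)"
    unfolding Int_stable_def
  proof safe
    fix a b :: real
    have "{..<a} \<inter> {..<b} = {..<min a b}" by auto
    then show "{..<a} \<inter> {..<b} \<in> range lessThan" by blast
  qed
  fix X :: "real set" assume "X \<in> range lessThan"
  then obtain a where X: "X = {..<a}" by auto
  have "emeasure ?M X = emeasure lborel (ball (0::real\<times>real) a)"
    unfolding X by (subst emeasure_distr) (auto simp: ball_def dist_norm intro!: arg_cong[where f="emeasure lborel"])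
  also have "\<dots> = emeasure ?N X"
  proof (cases "a \<le> 0")
    case True
    have "emeasure ?N X = (\<integral>\<^sup>+r. 0 \<partial>(lborel::real measure))"
      unfolding X
      by (subst emeasure_density, simp, simp, rule nn_integral_cong) (use True in \<open>auto simp: indicator_def\<close>)
    then show ?thesis using True by (simp add: ball_empty)
  next
    case False
    have "emeasure ?N X = (\<integral>\<^sup>+r. ennreal (2 * pi * r) * indicator {0..a} r \<partial>lborel)"
      unfolding X
      by (subst emeasure_density, simp, simp, rule nn_integral_cong_AE)
         (use AE_lborel_singleton[of a] in \<open>auto simp: indicator_def split: if_splits\<close>)
    also have "\<dots> = ennreal (pi * a\<^sup>2 - pi * 0\<^sup>2)"
      by (rule nn_integral_FTC_Icc) (use False in \<open>auto intro!: derivative_eq_intros\<close>)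
    finally show ?thesis
      using False by (simp add: emeasure_ball unit_ball_vol_2 numeral_2_eq_2[symmetric])
  qed
  finally show "emeasure ?M X = emeasure ?N X" .
next
  show "(\<Union>i. {..<real i}) = UNIV"
    using reals_Archimedean2 by auto
next
  fix i :: nat
  have "emeasure ?M {..<real i} = emeasure lborel (ball (0::real\<times>real) (real i))"
    by (subst emeasure_distr) (auto simp: ball_def dist_norm intro!: arg_cong[where f="emeasure lborel"])
  then show "emeasure ?M {..<real i} \<noteq> \<infinity>"
    using emeasure_lborel_ball_finite[of "0::real\<times>real" "real i"] by simp
qed (auto simp: borel_Iio)

lemma polar_norm_exists: "\<exists>\<tau>. p = polar (norm p) \<tau>"
proof -
  obtain x y where p: "p = (x, y)" by (cases p)
  show ?thesis
  proof (cases "norm p = 0")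
    case True
    then show ?thesis by (auto simp: polar_def zero_prod_def)
  next
    case False
    have "(norm p)\<^sup>2 = x\<^sup>2 + y\<^sup>2" by (simp add: p norm_prod_def)
    then have "(x / norm p)\<^sup>2 + (y / norm p)\<^sup>2 = 1"
      using False by (simp only: power_divide add_divide_distrib[symmetric]) (auto simp: p zero_prod_def)
    then obtain t where "x / norm p = cos t" "y / norm p = sin t"
      using sincos_total_2pi by metis
    then have "p = polar (norm p) t"
      using False by (simp add: polar_def p field_simps)
    then show ?thesis by blast
  qed
qed

lemma continuous_on_polar [continuous_intros]:
  assumes "continuous_on S f" "continuous_on S g"
  shows "continuous_on S (\<lambda>x. polar (f x) (g x))"
  unfolding polar_def using assms
  by (intro continuous_intros continuous_on_compose2[of UNIV cos] continuous_on_compose2[of UNIV sin]) auto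

lemma measurable_polar_pair [measurable]: "(\<lambda>(r, \<theta>). polar r \<theta>) \<in> borel_measurable borel"
  unfolding split_def by (intro borel_measurable_continuous_onI continuous_intros)

lemma polar_section_borel:
  assumes "E \<in> sets borel"
  shows "{\<theta>. polar r \<theta> \<in> E} \<in> sets borel"
proof -
  have "polar r \<in> borel_measurable borel"
    by (intro borel_measurable_continuous_onI continuous_intros)
  from measurable_sets[OF this assms] show ?thesis
    by (simp add: vimage_def)
qed

lemma polar_periodic [simp]: "polar r (\<theta> + 2 * pi) = polar r \<theta>"
  by (simp add: polar_def)

lemma angular_measure_shift:
  assumes "E \<in> sets borel"
  shows "emeasure lborel {\<theta>\<in>{a..<a+2*pi}. polar r \<theta> \<in> E} = emeasure lborel {\<theta>\<in>{0..<2*pi}. polar r \<theta> \<in> E}"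
proof -
  have "emeasure lborel ({\<theta>. polar r \<theta> \<in> E} \<inter> {a..<a+2*pi}) = emeasure lborel ({\<theta>. polar r \<theta> \<in> E} \<inter> {0..<2*pi})"
    by (rule emeasure_periodic_interval) (auto simp: polar_section_borel assms)
  then show ?thesis by (simp add: Int_def conj_commute)
qed

text \<open>Averaging over all rotations replaces the indicator of \<open>E\<close> by a radial function,
  and radial functions are integrated against the distribution of the norm.\<close>

lemma emeasure_polar:
  assumes E [measurable]: "E \<in> sets borel"
  shows "emeasure lborel E =
    (\<integral>\<^sup>+r. ennreal r * emeasure lborel {\<theta>\<in>{0..<2*pi}. polar r \<theta> \<in> E} * indicator {0..} r \<partial>lborel)"
proof -
  define h where "h r = emeasure lborel {\<theta>\<in>{0..<2*pi}. polar r \<theta> \<in> E}" for r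
  have h_int: "h r = (\<integral>\<^sup>+\<theta>. indicator {0..<2*pi} \<theta> * indicator E (polar r \<theta>) \<partial>lborel)" for r
  proof -
    have "h r = (\<integral>\<^sup>+\<theta>. indicator {\<theta>\<in>{0..<2*pi}. polar r \<theta> \<in> E} \<theta> \<partial>lborel)"
      unfolding h_def using polar_section_borel[OF E, of r]
      by (subst nn_integral_indicator) (auto simp: Collect_conj_eq)
    also have "\<dots> = (\<integral>\<^sup>+\<theta>. indicator {0..<2*pi} \<theta> * indicator E (polar r \<theta>) \<partial>lborel)"
      by (intro nn_integral_cong) (auto simp: indicator_def)
    finally show ?thesis .
  qed
  have [measurable]: "(\<lambda>p. polar (fst p) (snd p)) \<in> borel_measurable (borel \<Otimes>\<^sub>M borel)"
    using measurable_polar_pair by (simp add: split_def borel_prod)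
  have hm [measurable]: "h \<in> borel_measurable borel"
    unfolding h_int[abs_def] by measurable
  have rm: "(\<lambda>q. rotate_plane (fst q) (snd q)) \<in> borel_measurable borel"
    unfolding rotate_plane_def by (intro borel_measurable_continuous_onI continuous_intros)
  have rm' [measurable]: "(\<lambda>q. rotate_plane (fst q) (snd q)) \<in> borel_measurable (borel \<Otimes>\<^sub>M borel)"
    using rm by (simp add: borel_prod)
  \<comment> \<open>Within one turn the shear factorisation fails only at the angle
    \<open>pi\<close>, a null set.\<close>
  have AEc: "AE \<theta> in lborel. \<theta> \<in> {0..<2*pi} \<longrightarrow> cos \<theta> \<noteq> -1"
    using AE_lborel_singleton[of pi]
  proof eventually_elim
    case (elim \<theta>)
    show ?case
    proof (intro impI notI)
      assume t: "\<theta> \<in> {0..<2*pi}" "cos \<theta> = -1"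
      then have "cos (\<theta> - pi) = 1" by simp
      then obtain n :: int where n: "\<theta> - pi = of_int n * 2 * pi"
        by (metis cos_one_2pi_int)
      then have "\<bar>of_int n * 2 * pi\<bar> \<le> pi" using t by auto
      then have "\<bar>of_int n\<bar> * 2 \<le> (1::real)" by (simp add: abs_mult)
      then have "n = 0" by linarith
      then show False using n elim by simp
    qed
  qed
  \<comment> \<open>As \<open>\<theta>\<close> runs over a full turn, the rotated \<open>p\<close>
    runs once over its circle; the angle \<open>\<tau>\<close> of \<open>p\<close> drops out by
    periodicity.\<close>
  have pr: "(\<integral>\<^sup>+\<theta>. indicator {0..<2*pi} \<theta> * indicator E (rotate_plane \<theta> p) \<partial>lborel) = h (norm p)" for p
  proof -
    obtain \<tau> where t: "p = polar (norm p) \<tau>" using polar_norm_exists by blast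
    have rp: "rotate_plane \<theta> p = polar (norm p) (\<theta> + \<tau>)" for \<theta>
      using rotate_plane_polar[of \<theta> "norm p" \<tau>] t by simp
    have "(\<integral>\<^sup>+\<theta>. indicator {0..<2*pi} \<theta> * indicator E (rotate_plane \<theta> p) \<partial>lborel)
        = (\<integral>\<^sup>+\<theta>. indicator {\<theta>. \<theta> + \<tau> \<in> {\<theta>\<in>{\<tau>..<\<tau>+2*pi}. polar (norm p) \<theta> \<in> E}} \<theta> \<partial>lborel)"
      unfolding rp by (intro nn_integral_cong) (auto simp: indicator_def)
    also have "\<dots> = emeasure lborel {\<theta>. \<theta> + \<tau> \<in> {\<theta>\<in>{\<tau>..<\<tau>+2*pi}. polar (norm p) \<theta> \<in> E}}"
    proof (rule nn_integral_indicator)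
      have "{\<theta>\<in>{\<tau>..<\<tau>+2*pi}. polar (norm p) \<theta> \<in> E} \<in> sets borel"
        using polar_section_borel[OF E, of "norm p"] by (auto simp: Collect_conj_eq)
      then have "(\<lambda>\<theta>. \<theta> + \<tau>) -` {\<theta>\<in>{\<tau>..<\<tau>+2*pi}. polar (norm p) \<theta> \<in> E} \<inter> space borel \<in> sets borel"
        by (rule measurable_sets[rotated]) simp
      then show "{\<theta>. \<theta> + \<tau> \<in> {\<theta>\<in>{\<tau>..<\<tau>+2*pi}. polar (norm p) \<theta> \<in> E}} \<in> sets lborel"
        by (simp add: vimage_def)
    qed
    also have "\<dots> = emeasure lborel {\<theta>\<in>{\<tau>..<\<tau>+2*pi}. polar (norm p) \<theta> \<in> E}"
      by (rule emeasure_lborel_translate) (use polar_section_borel[OF E, of "norm p"] in \<open>auto simp: Collect_conj_eq\<close>)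
    also have "\<dots> = h (norm p)"
      unfolding h_def by (rule angular_measure_shift[OF E])
    finally show ?thesis .
  qed
  \<comment> \<open>Every rotation contributes the same area, whence the factor
    \<open>2 * pi\<close>; it cancels at the end against the same factor in the density of the
    norm.\<close>
  have "ennreal (2 * pi) * emeasure lborel E = (\<integral>\<^sup>+\<theta>. indicator {0..<2*pi} \<theta> * emeasure lborel E \<partial>lborel)"
    by (subst nn_integral_multc) auto
  also have "\<dots> = (\<integral>\<^sup>+\<theta>. (\<integral>\<^sup>+p. indicator {0..<2*pi} \<theta> * indicator E (rotate_plane \<theta> p) \<partial>lborel) \<partial>lborel)"
  proof (rule nn_integral_cong_AE, use AEc in eventually_elim)
    fix \<theta> :: real assume c: "\<theta> \<in> {0..<2*pi} \<longrightarrow> cos \<theta> \<noteq> -1"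
    show "indicator {0..<2*pi} \<theta> * emeasure lborel E = (\<integral>\<^sup>+p. indicator {0..<2*pi} \<theta> * indicator E (rotate_plane \<theta> p) \<partial>lborel)"
    proof (cases "\<theta> \<in> {0..<2*pi}")
      case True
      then show ?thesis
        using nn_integral_rotate_plane[of "indicator E" \<theta>] c by simp
    qed simp
  qed
  also have "\<dots> = (\<integral>\<^sup>+p. (\<integral>\<^sup>+\<theta>. indicator {0..<2*pi} \<theta> * indicator E (rotate_plane \<theta> p) \<partial>lborel) \<partial>lborel)"
    by (rule pair_sigma_finite.Fubini'[symmetric])
       (auto simp: pair_sigma_finite_def sigma_finite_lborel)
  also have "\<dots> = (\<integral>\<^sup>+p. h (norm (p::real\<times>real)) \<partial>lborel)"
    unfolding pr ..
  also have "\<dots> = (\<integral>\<^sup>+r. h r \<partial>(distr lborel borel (norm :: real \<times> real \<Rightarrow> real)))"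
    by (subst nn_integral_distr) auto
  also have "\<dots> = (\<integral>\<^sup>+r. ennreal (if 0 \<le> r then 2 * pi * r else 0) * h r \<partial>lborel)"
    unfolding distr_norm_plane by (subst nn_integral_density) auto
  also have "\<dots> = (\<integral>\<^sup>+r. ennreal (2 * pi) * (ennreal r * h r * indicator {0..} r) \<partial>lborel)"
    by (intro nn_integral_cong) (auto simp: indicator_def ennreal_mult mult.assoc)
  also have "\<dots> = ennreal (2 * pi) * (\<integral>\<^sup>+r. ennreal r * h r * indicator {0..} r \<partial>lborel)"
    by (rule nn_integral_cmult) measurable
  finally show ?thesis
    unfolding h_def by (simp add: ennreal_mult_cancel_left)
qed

section \<open>Area bounds from the angular measure on circles\<close>

lemma angular_emeasure_le_2pi:
  assumes "E \<in> sets borel"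
  shows "emeasure lborel {\<theta>\<in>{0..<2*pi}. polar r \<theta> \<in> E} \<le> ennreal (2 * pi)"
proof -
  have "emeasure lborel {\<theta>\<in>{0..<2*pi}. polar r \<theta> \<in> E} \<le> emeasure lborel {0..<2*pi}"
    by (rule emeasure_mono) auto
  then show ?thesis by simp
qed

lemma norm_polar [simp]: "norm (polar r \<theta>) = \<bar>r\<bar>"
  by (simp add: polar_def norm_prod_def power_mult_distrib distrib_left[symmetric])

text \<open>Circles of radius above \<open>B\<close> miss \<open>E\<close>, so a bound
  \<open>w\<close> on the angular measure up to \<open>B\<close>, integrated against
  \<open>r\<close>, bounds the whole area.\<close>

lemma measure_le_polar_integral:
  assumes E: "E \<in> sets borel"
    and bdd: "\<And>p. p \<in> E \<Longrightarrow> norm p < B"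
    and w: "\<And>r. r \<in> {0..B} \<Longrightarrow> emeasure lborel {\<theta>\<in>{0..<2*pi}. polar r \<theta> \<in> E} \<le> ennreal (w r)"
    and w0: "\<And>r. r \<in> {0..B} \<Longrightarrow> 0 \<le> w r"
    and W: "((\<lambda>r. r * w r) has_integral W) {0..B}"
  shows "measure lborel E \<le> W"
proof -
  have W0: "0 \<le> W"
    by (rule has_integral_nonneg[OF W]) (use w0 in auto)
  have "emeasure lborel E =
    (\<integral>\<^sup>+r. ennreal r * emeasure lborel {\<theta>\<in>{0..<2*pi}. polar r \<theta> \<in> E} * indicator {0..} r \<partial>lborel)"
    by (rule emeasure_polar[OF E])
  also have "\<dots> \<le> (\<integral>\<^sup>+r. ennreal (r * w r) * indicator {0..B} r \<partial>lborel)"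
  proof (rule nn_integral_mono)
    fix r :: real
    consider "r < 0" | "r \<in> {0..B}" | "r \<ge> 0" "r > B" by force
    then show "ennreal r * emeasure lborel {\<theta>\<in>{0..<2*pi}. polar r \<theta> \<in> E} * indicator {0..} r
        \<le> ennreal (r * w r) * indicator {0..B} r"
    proof cases
      case 2
      then show ?thesis using w[OF 2] w0[OF 2]
        by (auto simp: ennreal_mult intro!: mult_left_mono)
    next
      case 3
      have "{\<theta>\<in>{0..<2*pi}. polar r \<theta> \<in> E} = {}"
        using bdd[of "polar r _"] 3 by auto
      then show ?thesis by (simp only: emeasure_empty) simp
    qed simp
  qed
  also have "\<dots> = ennreal W"
    by (rule nn_integral_has_integral_lebesgue'[OF _ W]) (use w0 in auto)
  finally show ?thesis
    using W0 by (simp add: measure_def enn2real_leI)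
qed

lemma polar_integral_le_measure:
  assumes E: "E \<in> sets borel" and fin: "emeasure lborel E < \<infinity>" and A: "0 \<le> A"
    and w: "\<And>r. r \<in> {A..B} \<Longrightarrow> ennreal (w r) \<le> emeasure lborel {\<theta>\<in>{0..<2*pi}. polar r \<theta> \<in> E}"
    and w0: "\<And>r. r \<in> {A..B} \<Longrightarrow> 0 \<le> w r"
    and W: "((\<lambda>r. r * w r) has_integral W) {A..B}"
  shows "W \<le> measure lborel E"
proof -
  have "ennreal W = (\<integral>\<^sup>+r. ennreal (r * w r) * indicator {A..B} r \<partial>lborel)"
    by (rule nn_integral_has_integral_lebesgue'[OF _ W, symmetric]) (use w0 A in auto)
  also have "\<dots> \<le> (\<integral>\<^sup>+r. ennreal r * emeasure lborel {\<theta>\<in>{0..<2*pi}. polar r \<theta> \<in> E} * indicator {0..} r \<partial>lborel)"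
  proof (rule nn_integral_mono)
    fix r :: real
    show "ennreal (r * w r) * indicator {A..B} r \<le>
        ennreal r * emeasure lborel {\<theta>\<in>{0..<2*pi}. polar r \<theta> \<in> E} * indicator {0..} r"
    proof (cases "r \<in> {A..B}")
      case True
      then show ?thesis using w[OF True] w0[OF True] A
        by (auto simp: ennreal_mult intro!: mult_left_mono)
    qed simp
  qed
  also have "\<dots> = emeasure lborel E"
    by (rule emeasure_polar[OF E, symmetric])
  finally have "ennreal W \<le> ennreal (measure lborel E)"
    using fin by (simp add: emeasure_eq_ennreal_measure)
  then show ?thesis by (simp add: ennreal_le_iff)
qed

section \<open>Distances and angles of points in polar form\<close>

lemma dist_polar_same_angle: "dist (polar r \<theta>) (polar s \<theta>) = \<bar>r - s\<bar>"
proof -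
  have "polar r \<theta> - polar s \<theta> = polar (r - s) \<theta>"
    by (simp add: polar_def algebra_simps)
  then show ?thesis by (simp add: dist_norm)
qed

text \<open>The law of cosines, split into the components along and across the ray at angle
  \<open>\<tau>\<close>, so that \<open>angle_close\<close> can bound each square
  separately.\<close>

lemma dist_polar_sq:
  "(dist (polar r \<theta>) (polar s \<tau>))\<^sup>2 = (r * cos (\<theta> - \<tau>) - s)\<^sup>2 + (r * sin (\<theta> - \<tau>))\<^sup>2"
proof -
  have "(dist (polar r \<theta>) (polar s \<tau>))\<^sup>2 = (r * cos \<theta> - s * cos \<tau>)\<^sup>2 + (r * sin \<theta> - s * sin \<tau>)\<^sup>2"
    by (simp add: polar_def dist_norm norm_prod_def)
  also have "\<dots> = r\<^sup>2 * ((sin \<theta>)\<^sup>2 + (cos \<theta>)\<^sup>2) + s\<^sup>2 * ((sin \<tau>)\<^sup>2 + (cos \<tau>)\<^sup>2) - 2 * r * s * cos (\<theta> - \<tau>)"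
    unfolding cos_diff by algebra
  also have "\<dots> = r\<^sup>2 + s\<^sup>2 - 2 * r * s * cos (\<theta> - \<tau>)"
    by (simp only: sin_cos_squared_add mult_1_right)
  also have "\<dots> = r\<^sup>2 * ((sin (\<theta> - \<tau>))\<^sup>2 + (cos (\<theta> - \<tau>))\<^sup>2) + s\<^sup>2 - 2 * r * s * cos (\<theta> - \<tau>)"
    by (simp only: sin_cos_squared_add)
  also have "\<dots> = (r * cos (\<theta> - \<tau>) - s)\<^sup>2 + (r * sin (\<theta> - \<tau>))\<^sup>2"
    by algebra
  finally show ?thesis .
qed

text \<open>The chord over an angle \<open>d\<close> has length
  \<open>2 * \<bar>r * sin (d / 2)\<bar>\<close>, which is at most the arc.\<close>

lemma dist_polar_same_radius: "dist (polar r \<theta>) (polar r \<tau>) \<le> \<bar>r\<bar> * \<bar>\<theta> - \<tau>\<bar>"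
proof -
  let ?d = "\<theta> - \<tau>"
  have "(dist (polar r \<theta>) (polar r \<tau>))\<^sup>2 = r\<^sup>2 * (((cos ?d)\<^sup>2 + (sin ?d)\<^sup>2) + 1 - 2 * cos ?d)"
    unfolding dist_polar_sq by algebra
  also have "\<dots> = r\<^sup>2 * (2 - 2 * cos (2 * (?d / 2)))"
    unfolding sin_cos_squared_add2 by (simp only: times_divide_eq_right nonzero_mult_div_cancel_left) simp
  also have "\<dots> = r\<^sup>2 * (4 * (sin (?d / 2))\<^sup>2)"
    unfolding cos_double_sin by simp
  also have "\<dots> \<le> r\<^sup>2 * (4 * (?d / 2)\<^sup>2)"
    using abs_sin_x_le_abs_x[of "?d / 2"]
    by (intro mult_left_mono) (simp_all only: abs_le_square_iff, auto)
  also have "\<dots> = (\<bar>r\<bar> * \<bar>\<theta> - \<tau>\<bar>)\<^sup>2"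
    by (simp add: power_mult_distrib power_divide)
  finally show ?thesis
    by (rule power2_le_imp_le) simp
qed

text \<open>On \<open>{0..pi/3}\<close> the cosine is at least 1/2, so \<open>2 * sin y - y\<close>
  is nondecreasing from 0; negative arguments follow by oddness.\<close>

lemma abs_le_2_abs_sin:
  assumes x: "\<bar>x\<bar> \<le> pi / 3"
  shows "\<bar>x\<bar> \<le> 2 * \<bar>sin x\<bar>"
proof -
  have *: "y \<le> 2 * sin y" if y: "0 \<le> y" "y \<le> pi / 3" for y :: real
  proof -
    have "2 * sin 0 - 0 \<le> 2 * sin y - y"
    proof (rule DERIV_nonneg_imp_nondecreasing[OF y(1)])
      fix z assume z: "0 \<le> z" "z \<le> y"
      have "cos (pi / 3) \<le> cos z"
        using z y by (intro cos_monotone_0_pi_le) auto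
      then have "0 \<le> 2 * cos z - 1" by (simp add: cos_60)
      moreover have "((\<lambda>z. 2 * sin z - z) has_real_derivative 2 * cos z - 1) (at z)"
        by (auto intro!: derivative_eq_intros)
      ultimately show "\<exists>D. ((\<lambda>z. 2 * sin z - z) has_real_derivative D) (at z) \<and> 0 \<le> D" by blast
    qed
    then show ?thesis by simp
  qed
  show ?thesis
    using *[of x] *[of "-x"] x by (cases "x \<ge> 0") auto
qed

text \<open>The component across the ray gives
  \<open>\<bar>sin \<delta>\<bar> < e / r < 1 / 2\<close>, the component along it gives
  \<open>cos \<delta> > 0\<close>. Together they confine \<open>\<delta>\<close> to
  \<open>pi / 3\<close>, where an angle is at most twice its sine.\<close>

lemma angle_close:
  assumes e: "0 < e" and r: "2 * e < r" and d: "dist (polar r \<theta>) (polar s \<tau>) < e" and s: "0 < s"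
  obtains n :: int where "\<bar>\<theta> - \<tau> - 2 * pi * of_int n\<bar> \<le> 2 * e / r"
proof -
  \<comment> \<open>Rounding to the nearest full turn reduces the angle difference to at most
    \<open>pi\<close> in absolute value.\<close>
  define n :: int where "n = round ((\<theta> - \<tau>) / (2 * pi))"
  define \<delta> where "\<delta> = \<theta> - \<tau> - 2 * pi * of_int n"
  have "\<bar>(\<theta> - \<tau>) / (2 * pi) - of_int n\<bar> \<le> 1 / 2"
    unfolding n_def using of_int_round_abs_le[of "(\<theta> - \<tau>) / (2 * pi)"] by (simp add: abs_minus_commute)
  moreover have "\<delta> = ((\<theta> - \<tau>) / (2 * pi) - of_int n) * (2 * pi)"
    by (simp add: \<delta>_def field_simps)
  ultimately have dpi: "\<bar>\<delta>\<bar> \<le> pi"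
    by (simp add: abs_mult)
  have sc: "cos (\<theta> - \<tau>) = cos \<delta>" "sin (\<theta> - \<tau>) = sin \<delta>"
    unfolding \<delta>_def by (simp_all add: cos_diff sin_diff mult.assoc[symmetric] cos_int_2pin sin_int_2pin)
  have sq: "(r * cos \<delta> - s)\<^sup>2 + (r * sin \<delta>)\<^sup>2 < e\<^sup>2"
    using dist_polar_sq[of r \<theta> s \<tau>] power_strict_mono[OF d, of 2] by (simp add: sc)
  have "(r * sin \<delta>)\<^sup>2 < e\<^sup>2"
    using sq zero_le_power2[of "r * cos \<delta> - s"] by linarith
  then have "\<bar>r * sin \<delta>\<bar> < e"
    using e by (simp add: abs_square_less_1 power2_less_imp_less[of "\<bar>r * sin \<delta>\<bar>" e])
  then have sn: "\<bar>sin \<delta>\<bar> < e / r"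
    using r e by (simp add: abs_mult field_simps)
  have "(r * cos \<delta> - s)\<^sup>2 < e\<^sup>2"
    using sq zero_le_power2[of "r * sin \<delta>"] by linarith
  then have c1: "\<bar>r * cos \<delta> - s\<bar> < e"
    using e by (simp add: power2_less_imp_less[of "\<bar>r * cos \<delta> - s\<bar>" e])
  \<comment> \<open>Angles near \<open>pi\<close> have small sine as well; they are ruled out by
    \<open>r * cos \<delta> > s - e > r - 2 * e > 0\<close>.\<close>
  have "\<bar>\<bar>r\<bar> - \<bar>s\<bar>\<bar> < e"
    using d norm_triangle_ineq3[of "polar r \<theta>" "polar s \<tau>"] by (simp add: dist_norm)
  then have "r * cos \<delta> > 0"
    using c1 s r e by linarith
  then have cpos: "cos \<delta> > 0"
    using r e by (simp add: zero_less_mult_iff)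
  have "\<bar>sin \<delta>\<bar> < 1 / 2"
  proof -
    have "e / r < 1 / 2" using r e by (simp add: field_simps)
    with sn show ?thesis by linarith
  qed
  then have "\<bar>sin \<delta>\<bar>\<^sup>2 \<le> (1 / 2)\<^sup>2"
    by (intro power_mono) auto
  then have "(1 / 2)\<^sup>2 \<le> (cos \<delta>)\<^sup>2"
    by (simp add: cos_squared_eq power_divide)
  then have "1 / 2 \<le> cos \<delta>"
    by (rule power2_le_imp_le) (use cpos in simp)
  then have c3: "cos (pi / 3) \<le> cos \<bar>\<delta>\<bar>"
    by (simp add: cos_60)
  have "\<bar>\<delta>\<bar> \<le> pi / 3"
  proof (rule ccontr)
    assume "\<not> \<bar>\<delta>\<bar> \<le> pi / 3"
    then have "cos \<bar>\<delta>\<bar> < cos (pi / 3)"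
      using dpi by (intro cos_monotone_0_pi) auto
    with c3 show False by linarith
  qed
  from abs_le_2_abs_sin[OF this] sn have "\<bar>\<delta>\<bar> \<le> 2 * e / r"
    by simp
  then show ?thesis
    unfolding \<delta>_def by (rule that)
qed

text \<open>The window of length \<open>2 * pi\<close> that starts at \<open>T1\<close> contains an
  initial piece of the interval of length \<open>min (2 * pi) (T2 - T1)\<close>, and within one
  window no direction is counted twice.\<close>

lemma angular_lower:
  assumes E: "E \<in> sets borel" and sub: "\<And>\<theta>. T1 < \<theta> \<Longrightarrow> \<theta> < T2 \<Longrightarrow> polar r \<theta> \<in> E"
  shows "ennreal (min (2 * pi) (T2 - T1)) \<le> emeasure lborel {\<theta>\<in>{0..<2*pi}. polar r \<theta> \<in> E}"
proof (cases "T1 < T2")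
  case False
  then show ?thesis by (simp add: ennreal_neg min_def)
next
  case True
  have "ennreal (min (2 * pi) (T2 - T1)) = emeasure lborel {T1<..<T1 + min (2 * pi) (T2 - T1)}"
    using True by (subst emeasure_lborel_Ioo) auto
  also have "\<dots> \<le> emeasure lborel {\<theta>\<in>{T1..<T1+2*pi}. polar r \<theta> \<in> E}"
    by (rule emeasure_mono)
       (use sub polar_section_borel[OF E, of r] in \<open>auto simp: Collect_conj_eq\<close>)
  finally show ?thesis unfolding angular_measure_shift[OF E] .
qed

section \<open>Neighbourhoods and Minkowski content\<close>

lemma eps_nbhd_UN_ball: "eps_nbhd B e = (\<Union>b\<in>B. ball b e)"
  by (auto simp: eps_nbhd_def dist_commute)

lemma eps_nbhd_Un: "eps_nbhd (A \<union> B) e = eps_nbhd A e \<union> eps_nbhd B e"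
  by (auto simp: eps_nbhd_def)

lemma borel_eps_nbhd [measurable]: "eps_nbhd B e \<in> sets borel"
  unfolding eps_nbhd_UN_ball by (intro borel_open open_UN) auto

lemma emeasure_eps_nbhd_finite:
  assumes "bounded B"
  shows "emeasure lborel (eps_nbhd B e) < \<infinity>"
proof -
  obtain M where M: "\<And>b. b \<in> B \<Longrightarrow> norm b \<le> M"
    using assms by (auto simp: bounded_iff)
  have "eps_nbhd B e \<subseteq> ball 0 (M + e)"
  proof
    fix x assume "x \<in> eps_nbhd B e"
    then obtain b where "b \<in> B" "dist x b < e" by (auto simp: eps_nbhd_def)
    then show "x \<in> ball 0 (M + e)"
      using M[of b] norm_triangle_ineq2[of x b] by (auto simp: dist_norm)
  qed
  then have "emeasure lborel (eps_nbhd B e) \<le> emeasure lborel (ball (0::real\<times>real) (M + e))"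
    by (rule emeasure_mono) auto
  also have "\<dots> < \<infinity>" by (rule emeasure_lborel_ball_finite)
  finally show ?thesis .
qed

section \<open>Box dimension from the growth of the neighbourhood area\<close>

text \<open>For \<open>e < 1\<close> a smaller \<open>s\<close> makes \<open>e powr (2 - s)\<close>
  smaller, so the lower bound at \<open>d\<close> persists for every \<open>s \<le> d\<close>, and
  both contents are at least \<open>c\<close> there. The sets of exponents with vanishing content
  are therefore exactly \<open>{d<..}\<close>, with infimum \<open>d\<close>.\<close>

lemma box_dim_eqI:
  assumes c: "c > 0" "\<forall>\<^sub>F e in at_right 0. c * e powr (2 - d) \<le> measure lborel (eps_nbhd B e)"
    and upper: "\<And>s. s > d \<Longrightarrow> ((\<lambda>e. measure lborel (eps_nbhd B e) / e powr (2 - s)) \<longlongrightarrow> 0) (at_right 0)"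
  shows "upper_box_dim B = d" "lower_box_dim B = d"
proof -
  have gt: "upper_mink_content s B = 0" "lower_mink_content s B = 0" if "s > d" for s
  proof -
    have "((\<lambda>e. ereal (measure lborel (eps_nbhd B e) / e powr (2 - s))) \<longlongrightarrow> ereal 0) (at_right 0)"
      using upper[OF that] by (simp only: lim_ereal)
    from lim_imp_Limsup[OF _ this] lim_imp_Liminf[OF _ this]
    show "upper_mink_content s B = 0" "lower_mink_content s B = 0"
      unfolding upper_mink_content_def lower_mink_content_def by (simp_all add: zero_ereal_def)
  qed
  have le: "upper_mink_content s B \<noteq> 0" "lower_mink_content s B \<noteq> 0" if "s \<le> d" for s
  proof -
    have "\<forall>\<^sub>F e in at_right 0. e < (1::real) \<and> 0 < e"
      by (auto simp: eventually_at_right[OF zero_less_one] intro!: exI[of _ 1])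
    with c(2) have "\<forall>\<^sub>F e in at_right 0. ereal c \<le> ereal (measure lborel (eps_nbhd B e) / e powr (2 - s))"
    proof eventually_elim
      case (elim e)
      have "c * e powr (2 - s) \<le> c * e powr (2 - d)"
        using elim c that by (intro mult_left_mono powr_mono') auto
      then show ?case using elim by (simp add: field_simps)
    qed
    then have l: "ereal c \<le> lower_mink_content s B"
      unfolding lower_mink_content_def by (rule Liminf_bounded)
    also have u: "\<dots> \<le> upper_mink_content s B"
      unfolding lower_mink_content_def upper_mink_content_def by (rule Liminf_le_Limsup) simp
    finally have "ereal c \<le> upper_mink_content s B" .
    with l c show "upper_mink_content s B \<noteq> 0" "lower_mink_content s B \<noteq> 0" by auto
  qed
  have "{s. upper_mink_content s B = 0} = {d<..}" "{s. lower_mink_content s B = 0} = {d<..}"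
    using gt le by (auto simp: not_less[symmetric])
  then show "upper_box_dim B = d" "lower_box_dim B = d"
    unfolding upper_box_dim_def lower_box_dim_def by simp_all
qed

text \<open>A positive finite limit at exponent \<open>d\<close> supplies both inputs of
  \<open>box_dim_eqI\<close>: the constant \<open>L / 2\<close> from below, and for
  \<open>s > d\<close> an extra factor \<open>e powr (s - d)\<close> that tends to 0.\<close>

lemma minkowski_measurableI:
  assumes L: "L > 0"
    and lim: "((\<lambda>e. measure lborel (eps_nbhd B e) / e powr (2 - d)) \<longlongrightarrow> L) (at_right 0)"
  shows "upper_box_dim B = d" "lower_box_dim B = d" "minkowski_measurable B"
proof -
  have pos: "\<forall>\<^sub>F e in at_right 0. (0::real) < e"
    by (simp add: eventually_at_right_less)
  have "\<forall>\<^sub>F e in at_right 0. L / 2 < measure lborel (eps_nbhd B e) / e powr (2 - d)"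
    using L by (intro order_tendstoD[OF lim]) auto
  with pos have low: "\<forall>\<^sub>F e in at_right 0. L / 2 * e powr (2 - d) \<le> measure lborel (eps_nbhd B e)"
    by eventually_elim (simp add: field_simps)
  have up: "((\<lambda>e. measure lborel (eps_nbhd B e) / e powr (2 - s)) \<longlongrightarrow> 0) (at_right 0)" if "s > d" for s
  proof -
    have "((\<lambda>e. e powr (s - d)) \<longlongrightarrow> 0) (at_right (0::real))"
      using that by (intro tendsto_zero_powrI[where b = "s - d"] tendsto_const tendsto_ident_at)
         (auto simp: eventually_at_filter)
    from tendsto_mult[OF lim this]
    have "((\<lambda>e. measure lborel (eps_nbhd B e) / e powr (2 - d) * e powr (s - d)) \<longlongrightarrow> 0) (at_right 0)"
      by simp
    moreover have "\<forall>\<^sub>F e in at_right 0. measure lborel (eps_nbhd B e) / e powr (2 - d) * e powr (s - d)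
        = measure lborel (eps_nbhd B e) / e powr (2 - s)"
      using pos by eventually_elim (simp add: powr_diff field_simps)
    ultimately show ?thesis by (rule Lim_transform_eventually)
  qed
  show d: "upper_box_dim B = d" "lower_box_dim B = d"
    using box_dim_eqI[OF _ low up] L by auto
  have "((\<lambda>e. ereal (measure lborel (eps_nbhd B e) / e powr (2 - d))) \<longlongrightarrow> ereal L) (at_right 0)"
    using lim by (simp only: lim_ereal)
  from lim_imp_Limsup[OF _ this] lim_imp_Liminf[OF _ this]
  have "upper_mink_content d B = ereal L" "lower_mink_content d B = ereal L"
    unfolding upper_mink_content_def lower_mink_content_def by simp_all
  then show "minkowski_measurable B"
    unfolding minkowski_measurable_def using d L by (simp add: Let_def)
qed

section \<open>Neighbourhoods of Lipschitz curves and of spirals\<close>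

lemma measure_ball_plane: "0 \<le> r \<Longrightarrow> measure lborel (ball (c::real\<times>real) r) = pi * r\<^sup>2"
  by (simp add: content_ball unit_ball_vol_2 numeral_2_eq_2[symmetric])

text \<open>Times are sorted into cells of length \<open>e / V\<close>, and one time is sampled per
  cell. The curve moves by less than \<open>e\<close> within a cell, so balls of radius
  \<open>2 * e\<close> around the samples cover the neighbourhood, and about
  \<open>\<Lambda> * V / e + 1\<close> of them suffice.\<close>

lemma measure_nbhd_lipschitz_image:
  fixes y :: "real \<Rightarrow> real \<times> real"
  assumes lip: "\<And>s t. s \<in> J \<Longrightarrow> t \<in> J \<Longrightarrow> dist (y s) (y t) \<le> V * \<bar>s - t\<bar>"
    and J: "J \<subseteq> {u..u + \<Lambda>}" and V: "V > 0" and e: "e > 0" and \<Lambda>: "\<Lambda> \<ge> 0"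
  shows "measure lborel (eps_nbhd (y ` J) e) \<le> 4 * pi * (\<Lambda> * V * e + e\<^sup>2)"
proof -
  define cell where "cell t = nat \<lfloor>(t - u) * V / e\<rfloor>" for t
  \<comment> \<open>The last cell index, the floor of \<open>\<Lambda> * V / e\<close>, can occur,
    hence the successor.\<close>
  define n where "n = Suc (nat \<lfloor>\<Lambda> * V / e\<rfloor>)"
  define c where "c i = (SOME t. t \<in> J \<and> cell t = i)" for i
  have sub: "eps_nbhd (y ` J) e \<subseteq> (\<Union>i<n. ball (y (c i)) (2 * e))"
  proof
    fix x assume "x \<in> eps_nbhd (y ` J) e"
    then obtain t where t: "t \<in> J" "dist x (y t) < e" by (auto simp: eps_nbhd_def)
    define i where "i = cell t"
    have ci: "c i \<in> J" "cell (c i) = i"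
      using someI[of "\<lambda>s. s \<in> J \<and> cell s = i" t] t unfolding c_def i_def by auto
    have le: "0 \<le> (s - u) * V / e" "(s - u) * V / e \<le> \<Lambda> * V / e" if "s \<in> J" for s
      using subsetD[OF J that] V e by (auto intro!: divide_right_mono mult_right_mono)
    have "i < n"
      using floor_mono[OF le(2)[OF t(1)]] unfolding i_def cell_def n_def by linarith
    have "\<lfloor>(t - u) * V / e\<rfloor> = \<lfloor>(c i - u) * V / e\<rfloor>"
      using ci(2) le(1)[OF t(1)] le(1)[OF ci(1)] unfolding i_def cell_def
      by (metis nat_eq_iff2 zero_le_floor nat_0_le)
    then have "\<bar>(t - u) * V / e - (c i - u) * V / e\<bar> < 1" by linarith
    also have "(t - u) * V / e - (c i - u) * V / e = (t - c i) * V / e"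
      by (simp add: diff_divide_distrib[symmetric] algebra_simps)
    finally have "V * \<bar>t - c i\<bar> < e"
      using V e by (simp add: abs_mult pos_divide_less_eq mult.commute)
    with lip[OF t(1) ci(1)] have "dist (y t) (y (c i)) < e" by linarith
    with t(2) have "dist x (y (c i)) < 2 * e"
      using dist_triangle[of x "y (c i)" "y t"] by linarith
    with \<open>i < n\<close> show "x \<in> (\<Union>i<n. ball (y (c i)) (2 * e))"
      by (auto simp: dist_commute)
  qed
  have "emeasure lborel (eps_nbhd (y ` J) e) \<le> emeasure lborel (\<Union>i<n. ball (y (c i)) (2 * e))"
    by (rule emeasure_mono[OF sub]) (auto intro!: borel_open)
  also have "\<dots> \<le> (\<Sum>i<n. emeasure lborel (ball (y (c i)) (2 * e)))"
    by (rule emeasure_subadditive_finite) auto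
  also have "\<dots> = (\<Sum>i<n. ennreal (pi * (2 * e)\<^sup>2))"
    using e by (intro sum.cong) (simp_all add: emeasure_ball unit_ball_vol_2 numeral_2_eq_2[symmetric])
  also have "\<dots> = ennreal (\<Sum>i<n. pi * (2 * e)\<^sup>2)"
    by (rule sum_ennreal) simp
  also have "(\<Sum>i<n. pi * (2 * e)\<^sup>2) = real n * (pi * (2 * e)\<^sup>2)"
    by simp
  finally have "measure lborel (eps_nbhd (y ` J) e) \<le> real n * (pi * (2 * e)\<^sup>2)"
    by (simp add: measure_def enn2real_leI)
  also have "\<dots> \<le> (\<Lambda> * V / e + 1) * (pi * (2 * e)\<^sup>2)"
  proof (rule mult_right_mono)
    have "0 \<le> \<Lambda> * V / e" using \<Lambda> V e by simp
    then show "real n \<le> \<Lambda> * V / e + 1" unfolding n_def by simp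
  qed simp
  also have "\<dots> = 4 * pi * (\<Lambda> * V * e + e\<^sup>2)"
    using e by (simp add: field_simps power2_eq_square)
  finally show ?thesis .
qed

text \<open>A point of the circle that is \<open>e\<close>-close to the spiral at time
  \<open>t\<close> has angle within \<open>2 * e / r\<close> of \<open>t + \<theta>0\<close>, modulo
  full turns. As \<open>t\<close> is confined to \<open>{T1..T2}\<close>, all such angles lie in one
  arc, lengthened by \<open>2 * e / r\<close> at either end.\<close>

lemma spiral_angular_upper:
  assumes e: "0 < e" and r: "2 * e < r" and T: "T1 \<le> T2"
    and pos: "\<And>t. t \<in> I \<Longrightarrow> 0 < \<rho> t"
    and time: "\<And>t. t \<in> I \<Longrightarrow> \<bar>\<rho> t - r\<bar> < e \<Longrightarrow> t \<in> {T1..T2}"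
  shows "emeasure lborel {\<theta>\<in>{0..<2*pi}. polar r \<theta> \<in> eps_nbhd ((\<lambda>t. polar (\<rho> t) (t + \<theta>0)) ` I) e}
           \<le> ennreal (T2 - T1 + 4 * e / r)"
proof -
  let ?E = "eps_nbhd ((\<lambda>t. polar (\<rho> t) (t + \<theta>0)) ` I) e"
  let ?l = "T2 - T1 + 4 * e / r"
  \<comment> \<open>The left end of that arc, which also serves as the start of the window of one
    full turn.\<close>
  define a where "a = T1 + \<theta>0 - 2 * e / r"
  show ?thesis
  proof (cases "?l < 2 * pi")
    case False
    have "emeasure lborel {\<theta>\<in>{0..<2*pi}. polar r \<theta> \<in> ?E} \<le> ennreal (2 * pi)"
      by (rule angular_emeasure_le_2pi) simp
    also have "\<dots> \<le> ennreal ?l" using False by (intro ennreal_leI) simp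
    finally show ?thesis .
  next
    case True
    have "{\<theta>\<in>{a..<a+2*pi}. polar r \<theta> \<in> ?E} \<subseteq> {a..a + ?l}"
    proof safe
      fix \<theta> assume th: "\<theta> \<in> {a..<a+2*pi}" and "polar r \<theta> \<in> ?E"
      then obtain t where t: "t \<in> I" "dist (polar r \<theta>) (polar (\<rho> t) (t + \<theta>0)) < e"
        by (auto simp: eps_nbhd_def)
      obtain n :: int where n: "\<bar>\<theta> - (t + \<theta>0) - 2 * pi * of_int n\<bar> \<le> 2 * e / r"
        using angle_close[OF e r t(2) pos[OF t(1)]] by blast
      have "\<bar>\<bar>r\<bar> - \<bar>\<rho> t\<bar>\<bar> < e"
        using t(2) norm_triangle_ineq3[of "polar r \<theta>" "polar (\<rho> t) (t + \<theta>0)"] by (simp add: dist_norm)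
      then have "\<bar>\<rho> t - r\<bar> < e" using pos[OF t(1)] r e by linarith
      from time[OF t(1) this] n have *: "a \<le> \<theta> - 2 * pi * of_int n" "\<theta> - 2 * pi * of_int n \<le> a + ?l"
        unfolding a_def by (auto simp: abs_le_iff)
      \<comment> \<open>Both \<open>\<theta>\<close> and its translate by \<open>n\<close> turns lie
        in the half-open window \<open>{a..<a+2*pi}\<close>, so they differ by less than one
        turn.\<close>
      with th True have "\<bar>2 * pi * of_int n\<bar> < 2 * pi"
        unfolding abs_less_iff atLeastLessThan_iff by linarith
      then have "\<bar>of_int n\<bar> < (1::real)" by (simp add: abs_mult)
      then have "n = 0" by linarith
      with * show "\<theta> \<in> {a..a + ?l}" by simp
    qed
    then have "emeasure lborel {\<theta>\<in>{a..<a+2*pi}. polar r \<theta> \<in> ?E} \<le> emeasure lborel {a..a + ?l}"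
      by (rule emeasure_mono) simp
    also have "\<dots> = ennreal ?l"
      using T e r by (subst emeasure_lborel_Icc) auto
    finally show ?thesis
      unfolding angular_measure_shift[OF borel_eps_nbhd] .
  qed
qed

section \<open>Power spirals\<close>

lemma has_real_derivative_inverse_power:
  fixes s :: real
  assumes "r \<noteq> s"
  shows "((\<lambda>r. 1 / (r - s) ^ n) has_real_derivative - (real n / (r - s) ^ Suc n)) (at r within A)"
proof -
  have *: "real n * u ^ (n - 1) / (u ^ n * u ^ n) = real n / u ^ Suc n" if "u \<noteq> 0" for u :: real
    using that by (cases n) (auto simp: field_simps)
  have "((\<lambda>r. 1 / (r - s) ^ n) has_real_derivative - (real n * (r - s) ^ (n - 1) / ((r - s) ^ n * (r - s) ^ n)))
      (at r within A)"
    using assms by (auto intro!: derivative_eq_intros simp: power2_eq_square)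
  then show ?thesis using *[of "r - s"] assms by simp
qed

text \<open>Mean value theorem: the slope \<open>n / z ^ Suc n\<close> at the intermediate point
  lies between its values at the two end points.\<close>

lemma inverse_power_diff_bounds:
  fixes x y :: real
  assumes "0 < x" "x < y"
  shows "real n * (y - x) / y ^ Suc n \<le> 1 / x ^ n - 1 / y ^ n"
    and "1 / x ^ n - 1 / y ^ n \<le> real n * (y - x) / x ^ Suc n"
proof -
  have D: "((\<lambda>x. 1 / x ^ n) has_real_derivative - (real n / z ^ Suc n)) (at z)" if "x \<le> z" for z
    using has_real_derivative_inverse_power[of z 0 n UNIV] that assms by simp
  obtain z where z: "x < z" "z < y" "1 / y ^ n - 1 / x ^ n = (y - x) * - (real n / z ^ Suc n)"
    using MVT2[OF assms(2), of "\<lambda>x. 1 / x ^ n" "\<lambda>z. - (real n / z ^ Suc n)"] D by blast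
  have eq: "1 / x ^ n - 1 / y ^ n = real n * (y - x) / z ^ Suc n"
  proof -
    have "1 / x ^ n - 1 / y ^ n = (y - x) * (real n / z ^ Suc n)" using z(3) by linarith
    then show ?thesis by (simp add: mult.commute)
  qed
  have "x ^ Suc n \<le> z ^ Suc n" "z ^ Suc n \<le> y ^ Suc n"
    using z assms by (intro power_mono; simp)+
  then show "real n * (y - x) / y ^ Suc n \<le> 1 / x ^ n - 1 / y ^ n"
    and "1 / x ^ n - 1 / y ^ n \<le> real n * (y - x) / x ^ Suc n"
    unfolding eq using z assms by (auto intro!: divide_left_mono mult_nonneg_nonneg mult_pos_pos simp del: power_Suc)
qed

text \<open>Writing \<open>r\<close> as \<open>(r - s) + s\<close> splits the integrand into two
  pure inverse powers of \<open>r - s\<close>. The upper area bound uses it with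
  \<open>s = e\<close>, the lower one with \<open>s = - e\<close>.\<close>

lemma has_integral_ramp_inverse_power:
  fixes s :: real
  assumes k: "k \<ge> 1" and xy: "s < x" "x \<le> y"
  shows "((\<lambda>r. r * (C / (r - s) ^ (2 * k + 1))) has_integral
     C * (1 / ((2 * real k - 1) * (x - s) ^ (2 * k - 1)) + s / (2 * real k * (x - s) ^ (2 * k))
        - 1 / ((2 * real k - 1) * (y - s) ^ (2 * k - 1)) - s / (2 * real k * (y - s) ^ (2 * k)))) {x..y}"
proof -
  define F where "F r = C * ((- 1 / (2 * real k - 1)) * (1 / (r - s) ^ (2 * k - 1))
    - s / (2 * real k) * (1 / (r - s) ^ (2 * k)))" for r
  have "(F has_vector_derivative r * (C / (r - s) ^ (2 * k + 1))) (at r within {x..y})" if r: "r \<in> {x..y}" for r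
  proof -
    have nz: "r - s \<noteq> 0" using r xy by auto
    have k': "real (2 * k - 1) = 2 * real k - 1" "Suc (2 * k - 1) = 2 * k" "2 * real k - 1 \<noteq> 0" "2 * real k \<noteq> 0"
      using k by (auto simp: of_nat_diff)
    have "(F has_real_derivative C * ((- 1 / (2 * real k - 1)) * - (real (2 * k - 1) / (r - s) ^ Suc (2 * k - 1))
        - s / (2 * real k) * - (real (2 * k) / (r - s) ^ Suc (2 * k)))) (at r within {x..y})"
      unfolding F_def[abs_def]
      by (intro DERIV_cmult DERIV_diff has_real_derivative_inverse_power) (use nz in auto)
    also have "C * ((- 1 / (2 * real k - 1)) * - (real (2 * k - 1) / (r - s) ^ Suc (2 * k - 1))
        - s / (2 * real k) * - (real (2 * k) / (r - s) ^ Suc (2 * k)))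
        = C * (1 / (r - s) ^ (2 * k) + s / (r - s) ^ Suc (2 * k))"
      unfolding k'(1,2) using k'(3,4) by simp
    also have "\<dots> = C * (((r - s) + s) / (r - s) ^ Suc (2 * k))"
    proof -
      have "(r - s) / (r - s) ^ Suc (2 * k) = 1 / (r - s) ^ (2 * k)" using nz by simp
      then show ?thesis by (simp only: add_divide_distrib)
    qed
    finally show ?thesis
      by (simp add: has_real_derivative_iff_has_vector_derivative mult_ac)
  qed
  from fundamental_theorem_of_calculus[OF xy(2) this]
  have "((\<lambda>r. r * (C / (r - s) ^ (2 * k + 1))) has_integral F y - F x) {x..y}" .
  moreover have "F y - F x = C * (1 / ((2 * real k - 1) * (x - s) ^ (2 * k - 1)) + s / (2 * real k * (x - s) ^ (2 * k))
        - 1 / ((2 * real k - 1) * (y - s) ^ (2 * k - 1)) - s / (2 * real k * (y - s) ^ (2 * k)))"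
    by (simp add: F_def right_diff_distrib distrib_left)
  ultimately show ?thesis by simp
qed

lemma has_integral_piecewise:
  fixes f g :: "real \<Rightarrow> real"
  assumes "a \<le> c" "c \<le> b" "(f has_integral i) {a..c}" "(g has_integral j) {c..b}"
  shows "((\<lambda>x. if x \<le> c then f x else g x) has_integral (i + j)) {a..b}"
proof (rule has_integral_combine[OF assms(1,2)])
  show "((\<lambda>x. if x \<le> c then f x else g x) has_integral i) {a..c}"
    by (rule has_integral_eq[OF _ assms(3)]) auto
  show "((\<lambda>x. if x \<le> c then f x else g x) has_integral j) {c..b}"
    by (rule has_integral_spike_finite[OF _ _ assms(4), of "{c}"]) auto
qed

lemma has_integral_ramp:
  fixes C :: real
  assumes "x \<le> y"
  shows "((\<lambda>r. r * C) has_integral C * (y\<^sup>2 - x\<^sup>2) / 2) {x..y}"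
proof -
  have "((\<lambda>r. r * C) has_integral C * y\<^sup>2 / 2 - C * x\<^sup>2 / 2) {x..y}"
    by (rule fundamental_theorem_of_calculus[OF assms])
       (auto intro!: derivative_eq_intros simp: has_real_derivative_iff_has_vector_derivative[symmetric])
  then show ?thesis by (simp add: field_simps)
qed

section \<open>Area asymptotics for spirals with affine inverse power of the radius\<close>

text \<open>The geometry of the case \<open>a = 0\<close>, detached from the differential equation.
  The half-line from \<open>t0\<close> in \<open>I\<close> makes the spiral wind all the way into
  the origin.\<close>

locale power_spiral =
  fixes k :: nat and \<rho> :: "real \<Rightarrow> real" and I :: "real set" and c \<theta>0 B t0 :: real
  assumes k_pos: "k \<ge> 1"
    and \<rho>_pos: "\<And>t. t \<in> I \<Longrightarrow> 0 < \<rho> t" and \<rho>_le: "\<And>t. t \<in> I \<Longrightarrow> \<rho> t \<le> B"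
    and profile: "\<And>t. t \<in> I \<Longrightarrow> 1 / \<rho> t ^ (2 * k) = 2 * real k * t + c"
    and t0: "t0 \<in> I" "{t0..} \<subseteq> I"
begin

abbreviation "S \<equiv> (\<lambda>t. polar (\<rho> t) (t + \<theta>0)) ` I"

text \<open>The time at which \<open>profile\<close> prescribes the radius \<open>r\<close>; that
  time need not lie in \<open>I\<close>.\<close>

definition "T r = (1 / r ^ (2 * k) - c) / (2 * real k)"

lemma T_diff:
  assumes "0 < x" "x < y"
  shows "(y - x) / y ^ (2 * k + 1) \<le> T x - T y" "T x - T y \<le> (y - x) / x ^ (2 * k + 1)"
proof -
  have T: "T x - T y = (1 / x ^ (2 * k) - 1 / y ^ (2 * k)) / (2 * real k)"
    by (simp add: T_def diff_divide_distrib)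
  have k: "2 * real k > 0" using k_pos by simp
  show "(y - x) / y ^ (2 * k + 1) \<le> T x - T y" "T x - T y \<le> (y - x) / x ^ (2 * k + 1)"
    unfolding T using inverse_power_diff_bounds[OF assms, of "2 * k"] k
    by (simp_all add: pos_le_divide_eq pos_divide_le_eq mult_ac)
qed

lemma \<rho>_less_iff:
  assumes "t \<in> I" "0 < x"
  shows "\<rho> t < x \<longleftrightarrow> T x < t" "x < \<rho> t \<longleftrightarrow> t < T x"
proof -
  have k: "2 * real k > 0" "2 * k > 0" using k_pos by simp_all
  have p: "\<rho> t ^ (2 * k) > 0" "x ^ (2 * k) > 0" using \<rho>_pos[OF assms(1)] assms by simp_all
  have m1: "x ^ (2 * k) \<le> \<rho> t ^ (2 * k) \<longleftrightarrow> x \<le> \<rho> t"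
    and m2: "\<rho> t ^ (2 * k) \<le> x ^ (2 * k) \<longleftrightarrow> \<rho> t \<le> x"
    using \<rho>_pos[OF assms(1)] assms k by (intro power_mono_iff; simp)+
  have "T x < t \<longleftrightarrow> 1 / x ^ (2 * k) < 1 / \<rho> t ^ (2 * k)"
    unfolding T_def profile[OF assms(1)] using k by (simp add: pos_divide_less_eq algebra_simps)
  also have "\<dots> \<longleftrightarrow> \<rho> t ^ (2 * k) < x ^ (2 * k)"
    using p by (simp add: field_simps)
  also have "\<dots> \<longleftrightarrow> \<rho> t < x"
    using m1 by (meson not_le)
  finally show "\<rho> t < x \<longleftrightarrow> T x < t" by simp
  have "t < T x \<longleftrightarrow> 1 / \<rho> t ^ (2 * k) < 1 / x ^ (2 * k)"
    unfolding T_def profile[OF assms(1)] using k by (simp add: pos_less_divide_eq algebra_simps)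
  also have "\<dots> \<longleftrightarrow> x ^ (2 * k) < \<rho> t ^ (2 * k)"
    using p by (simp add: field_simps)
  also have "\<dots> \<longleftrightarrow> x < \<rho> t"
    using m2 by (meson not_le)
  finally show "x < \<rho> t \<longleftrightarrow> t < T x" by simp
qed

lemma B_pos: "B > 0"
  using \<rho>_pos[OF t0(1)] \<rho>_le[OF t0(1)] by linarith

lemma S_bounded: "bounded S"
  unfolding bounded_iff using \<rho>_pos \<rho>_le by (intro exI[of _ B]) (auto simp: abs_of_pos)

text \<open>Circles up to radius \<open>\<sigma> + e\<close> are counted with the full angle.
  Beyond, the crossing times lie between \<open>T (r + e)\<close> and \<open>T (r - e)\<close>, and
  \<open>T_diff\<close> bounds their span by \<open>2 * e / (r - e) ^ (2 * k + 1)\<close>; the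
  summand \<open>4 * e / r\<close> is the angular error. The cut at \<open>\<sigma> + e\<close>
  makes the integral in \<open>r - e\<close> start at \<open>\<sigma>\<close>.\<close>

lemma measure_upper:
  assumes e: "0 < e" "e < \<sigma>" "\<sigma> \<le> B"
  shows "measure lborel (eps_nbhd S e) \<le> pi * (\<sigma> + e)\<^sup>2
    + 2 * e * (1 / ((2 * real k - 1) * \<sigma> ^ (2 * k - 1)) + e / (2 * real k * \<sigma> ^ (2 * k))) + 4 * e * B"
proof -
  define w where "w r = (if r \<le> \<sigma> + e then 2 * pi else 2 * e / (r - e) ^ (2 * k + 1) + 4 * e / r)" for r
  define W where "W = 2 * pi * ((\<sigma> + e)\<^sup>2 - 0\<^sup>2) / 2 +
     (2 * e * (1 / ((2 * real k - 1) * (\<sigma> + e - e) ^ (2 * k - 1)) + e / (2 * real k * (\<sigma> + e - e) ^ (2 * k))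
        - 1 / ((2 * real k - 1) * (B + e - e) ^ (2 * k - 1)) - e / (2 * real k * (B + e - e) ^ (2 * k)))
      + 4 * e * (B - \<sigma>))"
  have "((\<lambda>r. 4 * e) has_integral 4 * e * (B - \<sigma>)) {\<sigma> + e..B + e}"
    using has_integral_const_real[of "4 * e" "\<sigma> + e" "B + e"] e by (simp add: mult.commute)
  then have "((\<lambda>r. r * (4 * e / r)) has_integral 4 * e * (B - \<sigma>)) {\<sigma> + e..B + e}"
    by (rule has_integral_eq[rotated]) (use e in auto)
  from has_integral_add[OF has_integral_ramp_inverse_power[OF k_pos, of e "\<sigma> + e" "B + e" "2 * e"] this] e
  have "((\<lambda>r. r * (2 * e / (r - e) ^ (2 * k + 1) + 4 * e / r)) has_integral
     (2 * e * (1 / ((2 * real k - 1) * (\<sigma> + e - e) ^ (2 * k - 1)) + e / (2 * real k * (\<sigma> + e - e) ^ (2 * k))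
        - 1 / ((2 * real k - 1) * (B + e - e) ^ (2 * k - 1)) - e / (2 * real k * (B + e - e) ^ (2 * k)))
      + 4 * e * (B - \<sigma>))) {\<sigma> + e..B + e}"
    unfolding distrib_left by simp
  from has_integral_piecewise[OF _ _ has_integral_ramp[of 0 "\<sigma> + e" "2 * pi"] this] e
  have "((\<lambda>r. if r \<le> \<sigma> + e then r * (2 * pi) else r * (2 * e / (r - e) ^ (2 * k + 1) + 4 * e / r)) has_integral W) {0..B + e}"
    unfolding W_def by simp
  then have WI: "((\<lambda>r. r * w r) has_integral W) {0..B + e}"
    by (rule has_integral_eq[rotated]) (auto simp: w_def)
  have "measure lborel (eps_nbhd S e) \<le> W"
  proof (rule measure_le_polar_integral[OF borel_eps_nbhd _ _ _ WI])
    fix p assume "p \<in> eps_nbhd S e"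
    then obtain t where t: "t \<in> I" "dist p (polar (\<rho> t) (t + \<theta>0)) < e"
      by (auto simp: eps_nbhd_def)
    then show "norm p < B + e"
      using norm_triangle_ineq2[of p "polar (\<rho> t) (t + \<theta>0)"] \<rho>_pos[OF t(1)] \<rho>_le[OF t(1)]
      by (simp add: dist_norm)
  next
    fix r assume "r \<in> {0..B + e}"
    then show "0 \<le> w r" using e by (auto simp: w_def)
  next
    fix r assume r: "r \<in> {0..B + e}"
    show "emeasure lborel {\<theta>\<in>{0..<2*pi}. polar r \<theta> \<in> eps_nbhd S e} \<le> ennreal (w r)"
    proof (cases "r \<le> \<sigma> + e")
      case True
      then show ?thesis unfolding w_def by (simp only: if_True angular_emeasure_le_2pi borel_eps_nbhd)
    next
      case False
      with e have r': "2 * e < r" "0 < r - e" "r - e < r + e" by auto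
      note Td = T_diff[OF r'(2,3)]
      have "emeasure lborel {\<theta>\<in>{0..<2*pi}. polar r \<theta> \<in> eps_nbhd S e} \<le> ennreal (T (r - e) - T (r + e) + 4 * e / r)"
      proof (rule spiral_angular_upper[OF e(1) r'(1) _ \<rho>_pos])
        have "0 \<le> (r + e - (r - e)) / (r + e) ^ (2 * k + 1)" using r' e by (auto intro!: divide_nonneg_nonneg)
        then show "T (r + e) \<le> T (r - e)" using Td(1) by linarith
        fix t assume t: "t \<in> I" "\<bar>\<rho> t - r\<bar> < e"
        then have "r - e < \<rho> t" "\<rho> t < r + e" by linarith+
        then show "t \<in> {T (r + e)..T (r - e)}"
          using \<rho>_less_iff(1)[OF t(1), of "r + e"] \<rho>_less_iff(2)[OF t(1), of "r - e"] r' e by auto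
      qed
      also have "\<dots> \<le> ennreal (w r)"
        using Td(2) False by (intro ennreal_leI) (simp add: w_def)
      finally show ?thesis .
    qed
  qed
  also have "W \<le> pi * (\<sigma> + e)\<^sup>2
    + 2 * e * (1 / ((2 * real k - 1) * \<sigma> ^ (2 * k - 1)) + e / (2 * real k * \<sigma> ^ (2 * k))) + 4 * e * B"
  proof -
    have "0 \<le> 1 / ((2 * real k - 1) * B ^ (2 * k - 1))" "0 \<le> e / (2 * real k * B ^ (2 * k))"
      using k_pos B_pos e by (auto intro!: divide_nonneg_nonneg mult_nonneg_nonneg)
    then have "2 * e * (1 / ((2 * real k - 1) * \<sigma> ^ (2 * k - 1)) + e / (2 * real k * \<sigma> ^ (2 * k))
        - 1 / ((2 * real k - 1) * B ^ (2 * k - 1)) - e / (2 * real k * B ^ (2 * k)))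
        \<le> 2 * e * (1 / ((2 * real k - 1) * \<sigma> ^ (2 * k - 1)) + e / (2 * real k * \<sigma> ^ (2 * k)))"
      using e by (intro mult_left_mono) linarith+
    moreover have "4 * e * (B - \<sigma>) \<le> 4 * e * B" using e by (intro mult_left_mono) auto
    ultimately show ?thesis unfolding W_def by simp
  qed
  finally show ?thesis .
qed

text \<open>A direction on the circle of radius \<open>r\<close> is compared with the spiral point
  at the same angle, so it counts when its time lies between \<open>T (r + e)\<close> and
  \<open>T (r - e)\<close>. The relation between \<open>e\<close> and \<open>\<sigma>\<close> makes
  \<open>2 * e / (r + e) ^ (2 * k + 1)\<close> equal to \<open>2 * pi\<close> exactly at
  \<open>r = \<sigma> - e\<close>, so \<open>w\<close> is the smaller of the two. Starting at
  \<open>2 * e\<close> keeps \<open>r - e\<close> positive.\<close>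

lemma measure_lower:
  assumes e: "0 < e" "3 * e < \<sigma>" "\<sigma> \<le> \<rho> t0" and \<sigma>: "e = pi * \<sigma> ^ (2 * k + 1)"
  shows "pi * ((\<sigma> - e)\<^sup>2 - (2 * e)\<^sup>2)
    + 2 * e * (1 / ((2 * real k - 1) * \<sigma> ^ (2 * k - 1)) - e / (2 * real k * \<sigma> ^ (2 * k))
               - 1 / ((2 * real k - 1) * \<rho> t0 ^ (2 * k - 1))) \<le> measure lborel (eps_nbhd S e)"
proof -
  define w where "w r = (if r \<le> \<sigma> - e then 2 * pi else 2 * e / (r + e) ^ (2 * k + 1))" for r
  let ?A = "\<rho> t0"
  define W where "W = 2 * pi * ((\<sigma> - e)\<^sup>2 - (2 * e)\<^sup>2) / 2 +
     2 * e * (1 / ((2 * real k - 1) * (\<sigma> - e - - e) ^ (2 * k - 1)) + - e / (2 * real k * (\<sigma> - e - - e) ^ (2 * k))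
        - 1 / ((2 * real k - 1) * (?A - e - - e) ^ (2 * k - 1)) - - e / (2 * real k * (?A - e - - e) ^ (2 * k)))"
  have "((\<lambda>r. if r \<le> \<sigma> - e then r * (2 * pi) else r * (2 * e / (r - - e) ^ (2 * k + 1))) has_integral W) {2 * e..?A - e}"
    unfolding W_def
    by (intro has_integral_piecewise has_integral_ramp has_integral_ramp_inverse_power k_pos) (use e in auto)
  then have WI: "((\<lambda>r. r * w r) has_integral W) {2 * e..?A - e}"
    by (rule has_integral_eq[rotated]) (auto simp: w_def)
  have "pi * ((\<sigma> - e)\<^sup>2 - (2 * e)\<^sup>2)
    + 2 * e * (1 / ((2 * real k - 1) * \<sigma> ^ (2 * k - 1)) - e / (2 * real k * \<sigma> ^ (2 * k))
               - 1 / ((2 * real k - 1) * ?A ^ (2 * k - 1))) \<le> W"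
  proof -
    have "0 \<le> e / (2 * real k * ?A ^ (2 * k))"
      using k_pos \<rho>_pos[OF t0(1)] e by (auto intro!: divide_nonneg_nonneg mult_nonneg_nonneg)
    then have "2 * e * (1 / ((2 * real k - 1) * \<sigma> ^ (2 * k - 1)) - e / (2 * real k * \<sigma> ^ (2 * k))
               - 1 / ((2 * real k - 1) * ?A ^ (2 * k - 1))) \<le>
      2 * e * (1 / ((2 * real k - 1) * \<sigma> ^ (2 * k - 1)) - e / (2 * real k * \<sigma> ^ (2 * k))
               - 1 / ((2 * real k - 1) * ?A ^ (2 * k - 1)) + e / (2 * real k * ?A ^ (2 * k)))"
      using e by (intro mult_left_mono) linarith+
    then show ?thesis unfolding W_def by simp
  qed
  also have "W \<le> measure lborel (eps_nbhd S e)"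
  proof (rule polar_integral_le_measure[OF borel_eps_nbhd emeasure_eps_nbhd_finite[OF S_bounded] _ _ _ WI])
    show "0 \<le> 2 * e" using e by simp
  next
    fix r assume "r \<in> {2 * e..?A - e}"
    then show "0 \<le> w r" using e by (auto simp: w_def)
  next
    fix r assume r: "r \<in> {2 * e..?A - e}"
    then have r': "0 < r - e" "r - e < r + e" "0 < r + e" using e by auto
    have "w r \<le> min (2 * pi) (2 * e / (r + e) ^ (2 * k + 1))"
    proof (cases "r \<le> \<sigma> - e")
      case True
      then have "(r + e) ^ (2 * k + 1) \<le> \<sigma> ^ (2 * k + 1)" using r' by (intro power_mono) auto
      then have "2 * pi * (r + e) ^ (2 * k + 1) \<le> 2 * e"
        unfolding \<sigma> by simp
      then have "2 * pi \<le> 2 * e / (r + e) ^ (2 * k + 1)"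
        using r' by (simp add: pos_le_divide_eq)
      then show ?thesis using True by (simp add: w_def)
    next
      case False
      then have "\<sigma> ^ (2 * k + 1) \<le> (r + e) ^ (2 * k + 1)" using r' e by (intro power_mono) auto
      then have "2 * e \<le> 2 * pi * (r + e) ^ (2 * k + 1)"
        unfolding \<sigma> by simp
      then have "2 * e / (r + e) ^ (2 * k + 1) \<le> 2 * pi"
        using r' by (simp add: pos_divide_le_eq)
      then show ?thesis using False by (simp add: w_def)
    qed
    also have "\<dots> \<le> min (2 * pi) ((T (r - e) + \<theta>0) - (T (r + e) + \<theta>0))"
      using T_diff(1)[OF r'(1,2)] by (intro min.mono) auto
    finally have "ennreal (w r) \<le> ennreal (min (2 * pi) ((T (r - e) + \<theta>0) - (T (r + e) + \<theta>0)))"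
      by (rule ennreal_leI)
    also have "\<dots> \<le> emeasure lborel {\<theta>\<in>{0..<2*pi}. polar r \<theta> \<in> eps_nbhd S e}"
    proof (rule angular_lower[OF borel_eps_nbhd])
      fix \<theta> assume th: "T (r + e) + \<theta>0 < \<theta>" "\<theta> < T (r - e) + \<theta>0"
      define t where "t = \<theta> - \<theta>0"
      have t: "T (r + e) < t" "t < T (r - e)" using th by (auto simp: t_def)
      \<comment> \<open>Since \<open>t0 = T (\<rho> t0)\<close> and
        \<open>r + e \<le> \<rho> t0\<close>, the times in question come after \<open>t0\<close> and
        hence belong to \<open>I\<close>.\<close>
      have "\<not> t0 < T ?A" using \<rho>_less_iff(2)[OF t0(1), of ?A] \<rho>_pos[OF t0(1)] by simp
      moreover have "T ?A \<le> T (r + e)"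
      proof (cases "r + e = ?A")
        case False
        then have "r + e < ?A" using r by auto
        moreover have "0 \<le> (?A - (r + e)) / ?A ^ (2 * k + 1)"
          using r' \<open>r + e < ?A\<close> by (auto intro!: divide_nonneg_nonneg)
        ultimately show ?thesis using T_diff(1)[of "r + e" ?A] r' by linarith
      qed simp
      moreover have "\<not> T ?A < t0" using \<rho>_less_iff(1)[OF t0(1), of ?A] \<rho>_pos[OF t0(1)] by simp
      ultimately have "t \<in> I" using t t0(2) by auto
      then have "\<rho> t < r + e" "r - e < \<rho> t"
        using \<rho>_less_iff[OF \<open>t \<in> I\<close>] t r' by auto
      then have "dist (polar r \<theta>) (polar (\<rho> t) (t + \<theta>0)) < e"
        by (simp add: t_def dist_polar_same_angle abs_less_iff)
      then show "polar r \<theta> \<in> eps_nbhd S e"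
        using \<open>t \<in> I\<close> unfolding eps_nbhd_def by blast
    qed
    finally show "ennreal (w r) \<le> emeasure lborel {\<theta>\<in>{0..<2*pi}. polar r \<theta> \<in> eps_nbhd S e}" .
  qed
  finally show ?thesis .
qed

text \<open>With \<open>\<sigma> e\<close> solving \<open>e = pi * \<sigma> ^ (2 * k + 1)\<close>,
  the area bounds of \<open>measure_upper\<close> and \<open>measure_lower\<close>, divided by
  \<open>\<sigma>^2\<close>, have the same limit: \<open>pi\<close> from the filled core and
  \<open>2 * pi / (2 * real k - 1)\<close> from the separated coils. Expressing
  \<open>\<sigma>^2\<close> through \<open>e\<close> gives the exponent
  \<open>2 / (2 * real k + 1)\<close> and the power of \<open>pi\<close>.\<close>

lemma minkowski_limit:
  "((\<lambda>e. measure lborel (eps_nbhd S e) / e powr (2 - 4 * real k / (2 * real k + 1))) \<longlongrightarrow>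
     (pi + 2 * pi / (2 * real k - 1)) / pi powr (2 / (2 * real k + 1))) (at_right 0)"
proof -
  define \<sigma> where "\<sigma> e = (e / pi) powr (1 / (2 * real k + 1))" for e
  \<comment> \<open>\<open>U\<close> and \<open>L\<close> are the two area bounds divided by
    \<open>x^2\<close> after substituting \<open>e = pi * x ^ (2 * k + 1)\<close>. Writing
    \<open>x ^ (2 * k)\<close> as \<open>x ^ (2 * k - 1) * x\<close> leaves two quantities that both
    tend to 0.\<close>
  define U where "U x = pi * (1 + pi * (x ^ (2 * k - 1) * x))\<^sup>2
     + 2 * pi * (1 / (2 * real k - 1) + pi * (x ^ (2 * k - 1) * x) / (2 * real k)) + 4 * pi * x ^ (2 * k - 1) * B" for x
  define L where "L x = pi * ((1 - pi * (x ^ (2 * k - 1) * x))\<^sup>2 - (2 * pi * (x ^ (2 * k - 1) * x))\<^sup>2)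
     + 2 * pi * (1 / (2 * real k - 1) - pi * (x ^ (2 * k - 1) * x) / (2 * real k)
        - x ^ (2 * k - 1) / ((2 * real k - 1) * \<rho> t0 ^ (2 * k - 1)))" for x
  let ?L = "pi + 2 * pi / (2 * real k - 1)"
  have k1: "2 * k - 1 > 0" "2 * real k - 1 > 0" "real k > 0" using k_pos by auto
  have pow: "\<sigma> e ^ (2 * k + 1) = e / pi" if "e > 0" for e
  proof -
    have "\<sigma> e ^ (2 * k + 1) = (e / pi) powr (of_nat (2 * k + 1) * (1 / (2 * real k + 1)))"
      unfolding \<sigma>_def using that by (intro powr_power) simp
    also have "of_nat (2 * k + 1) * (1 / (2 * real k + 1)) = (1::real)"
      by (simp add: field_simps)
    finally show ?thesis using that by simp
  qed
  have pos: "\<sigma> e > 0" if "e > 0" for e using that by (simp add: \<sigma>_def)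
  have ev0: "\<forall>\<^sub>F e in at_right 0. (0::real) < e"
    by (simp add: eventually_at_right_less)
  have "(\<sigma> \<longlongrightarrow> 0) (at_right 0)"
    unfolding \<sigma>_def[abs_def]
  proof (rule tendsto_zero_powrI)
    show "((\<lambda>e. e / pi) \<longlongrightarrow> 0) (at_right 0)"
      by (auto intro!: tendsto_eq_intros)
    show "\<forall>\<^sub>F e in at_right 0. 0 \<le> e / pi"
      using ev0 by eventually_elim simp
  qed (auto intro!: tendsto_const)
  note \<sigma>0 = this
  have X0: "((\<lambda>e. \<sigma> e ^ (2 * k - 1)) \<longlongrightarrow> 0) (at_right 0)"
    using tendsto_power[OF \<sigma>0, of "2 * k - 1"] k1 by (simp add: power_0_left)
  have X1: "((\<lambda>e. \<sigma> e ^ (2 * k - 1) * \<sigma> e) \<longlongrightarrow> 0) (at_right 0)"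
    using tendsto_mult[OF X0 \<sigma>0] by simp
  have Ulim: "((\<lambda>e. U (\<sigma> e)) \<longlongrightarrow> ?L) (at_right 0)"
  proof -
    have "((\<lambda>e. pi * (1 + pi * g e)\<^sup>2 + 2 * pi * (1 / (2 * real k - 1) + pi * g e / (2 * real k)) + 4 * pi * f e * B)
        \<longlongrightarrow> pi * (1 + pi * 0)\<^sup>2 + 2 * pi * (1 / (2 * real k - 1) + pi * 0 / (2 * real k)) + 4 * pi * 0 * B) F"
      if "(f \<longlongrightarrow> 0) F" "(g \<longlongrightarrow> 0) F" for f g :: "real \<Rightarrow> real" and F
      using k1 by (intro tendsto_intros that) auto
    from this[OF X0 X1] show ?thesis unfolding U_def by simp
  qed
  have Llim: "((\<lambda>e. L (\<sigma> e)) \<longlongrightarrow> ?L) (at_right 0)"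
  proof -
    let ?D = "(2 * real k - 1) * \<rho> t0 ^ (2 * k - 1)"
    have D: "?D \<noteq> 0" using k1 \<rho>_pos[OF t0(1)] by simp
    have "((\<lambda>e. pi * ((1 - pi * g e)\<^sup>2 - (2 * pi * g e)\<^sup>2)
          + 2 * pi * (1 / (2 * real k - 1) - pi * g e / (2 * real k) - f e / ?D))
        \<longlongrightarrow> pi * ((1 - pi * 0)\<^sup>2 - (2 * pi * 0)\<^sup>2)
          + 2 * pi * (1 / (2 * real k - 1) - pi * 0 / (2 * real k) - 0 / ?D)) F"
      if "(f \<longlongrightarrow> 0) F" "(g \<longlongrightarrow> 0) F" for f g :: "real \<Rightarrow> real" and F
      using k1 by (intro tendsto_intros that D) auto
    from this[OF X0 X1] show ?thesis unfolding L_def by simp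
  qed
  have ev1: "\<forall>\<^sub>F e in at_right 0. \<sigma> e < \<rho> t0"
    using order_tendstoD(2)[OF \<sigma>0 \<rho>_pos[OF t0(1)]] .
  \<comment> \<open>Since \<open>e / \<sigma> e = pi * \<sigma> e ^ (2 * k)\<close>, this threshold
    says \<open>3 * e < \<sigma> e\<close>, as \<open>measure_lower\<close> requires.\<close>
  have ev2: "\<forall>\<^sub>F e in at_right 0. \<sigma> e ^ (2 * k - 1) * \<sigma> e < 1 / (3 * pi)"
    by (rule order_tendstoD(2)[OF X1]) simp
  have ev: "\<forall>\<^sub>F e in at_right 0. L (\<sigma> e) \<le> measure lborel (eps_nbhd S e) / (\<sigma> e)\<^sup>2 \<and>
      measure lborel (eps_nbhd S e) / (\<sigma> e)\<^sup>2 \<le> U (\<sigma> e)"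
    using ev0 ev1 ev2
  proof eventually_elim
    case (elim e)
    define s where "s = \<sigma> e"
    define X where "X = s ^ (2 * k - 1)"
    have s: "s > 0" "X > 0" using pos[OF elim(1)] by (simp_all add: s_def X_def)
    have Xs: "s ^ (2 * k) = X * s"
      unfolding X_def using k1 by (simp flip: power_Suc2)
    have e_s: "e = pi * s ^ (2 * k + 1)"
      using pow[OF elim(1)] unfolding s_def[symmetric] by simp
    then have eX: "e = pi * (X * s * s)"
      unfolding power_add Xs by simp
    have "3 * pi * (X * s) < 1"
      using elim(3) unfolding s_def[symmetric] X_def[symmetric] by (simp add: field_simps)
    then have "3 * pi * (X * s) * s < 1 * s" using s by (intro mult_strict_right_mono) auto
    then have e3: "3 * e < s" unfolding eX by (simp add: mult_ac)
    have sA: "s \<le> \<rho> t0" using elim(2) by (simp add: s_def)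
    have "e < s" "s \<le> B" using e3 elim(1) sA \<rho>_le[OF t0(1)] by auto
    note up = measure_upper[OF elim(1) this]
    note lo = measure_lower[OF elim(1) e3 sA e_s]
    have "pi * (s + e)\<^sup>2 + 2 * e * (1 / ((2 * real k - 1) * X) + e / (2 * real k * (X * s))) + 4 * e * B = s\<^sup>2 * U s"
      unfolding U_def X_def[symmetric] eX using s k1 by (simp add: divide_simps) (simp add: algebra_simps power2_eq_square)
    with up have 1: "measure lborel (eps_nbhd S e) \<le> s\<^sup>2 * U s"
      by (simp only: X_def[symmetric] Xs)
    have "pi * ((s - e)\<^sup>2 - (2 * e)\<^sup>2)
       + 2 * e * (1 / ((2 * real k - 1) * X) - e / (2 * real k * (X * s))
               - 1 / ((2 * real k - 1) * \<rho> t0 ^ (2 * k - 1))) = s\<^sup>2 * L s"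
      unfolding L_def X_def[symmetric] eX using s k1 \<rho>_pos[OF t0(1)]
      by (simp add: divide_simps) (simp add: algebra_simps power2_eq_square)
    with lo have 2: "s\<^sup>2 * L s \<le> measure lborel (eps_nbhd S e)"
      by (simp only: X_def[symmetric] Xs)
    show ?case
      unfolding s_def[symmetric] using 1 2 s by (simp add: pos_le_divide_eq pos_divide_le_eq mult.commute)
  qed
  have "((\<lambda>e. measure lborel (eps_nbhd S e) / (\<sigma> e)\<^sup>2) \<longlongrightarrow> ?L) (at_right 0)"
    by (rule tendsto_sandwich[OF _ _ Llim Ulim]) (use ev in \<open>auto elim: eventually_mono\<close>)
  then have "((\<lambda>e. measure lborel (eps_nbhd S e) / (\<sigma> e)\<^sup>2 / pi powr (2 / (2 * real k + 1))) \<longlongrightarrow>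
      ?L / pi powr (2 / (2 * real k + 1))) (at_right 0)"
    by (intro tendsto_divide tendsto_const) auto
  moreover have "\<forall>\<^sub>F e in at_right 0. measure lborel (eps_nbhd S e) / (\<sigma> e)\<^sup>2 / pi powr (2 / (2 * real k + 1)) =
      measure lborel (eps_nbhd S e) / e powr (2 - 4 * real k / (2 * real k + 1))"
    using ev0
  proof eventually_elim
    case (elim e)
    have ex: "2 - 4 * real k / (2 * real k + 1) = 2 / (2 * real k + 1)"
      by (simp add: field_simps)
    have "(\<sigma> e)\<^sup>2 = (e / pi) powr (of_nat 2 * (1 / (2 * real k + 1)))"
      unfolding \<sigma>_def using elim by (intro powr_power) simp
    also have "\<dots> = e powr (2 / (2 * real k + 1)) / pi powr (2 / (2 * real k + 1))"
      using elim by (simp add: powr_divide)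
    finally show ?case unfolding ex by simp
  qed
  ultimately show ?thesis by (rule Lim_transform_eventually)
qed

end

section \<open>Orbits of the inverted Hopf system\<close>

text \<open>Serves to turn a gap between \<open>2 * k\<close>-th powers of radii into a gap between
  the radii near the limit cycle.\<close>

lemma power_diff_ge:
  fixes x y :: real
  assumes "0 \<le> y" "y \<le> x" "n > 0"
  shows "x ^ (n - 1) * (x - y) \<le> x ^ n - y ^ n"
proof -
  obtain m where m: "n = Suc m" using assms(3) by (cases n) auto
  have "y * y ^ m \<le> y * x ^ m" using assms by (intro mult_left_mono power_mono) auto
  then show ?thesis unfolding m by (simp add: algebra_simps)
qed

locale hopf_inversion_orbit =
  fixes k :: nat and a :: real and \<phi> :: "real \<Rightarrow> real \<times> real" and I :: "real set" and \<delta> :: real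
  assumes k_pos: "k \<ge> 1"
    and I_interval: "is_interval I"
    and solution: "\<And>t. t \<in> I \<Longrightarrow> (\<phi> has_vector_derivative hopf_inv_field k a (\<phi> t)) (at t within I)"
    and unbounded: "\<not> bounded (\<phi> ` I)"
    and \<delta>_pos: "\<delta> > 0" and away: "\<And>t. t \<in> I \<Longrightarrow> \<delta> \<le> norm (\<phi> t)"
begin

section \<open>Radial and angular equations along an orbit\<close>

definition "N t = (fst (\<phi> t))\<^sup>2 + (snd (\<phi> t))\<^sup>2"
definition "q t = N t ^ k"
definition "\<rho> t = 1 / norm (\<phi> t)"

lemma N_norm: "N t = (norm (\<phi> t))\<^sup>2"
  by (simp add: N_def norm_prod_def)

lemma norm_pos: "t \<in> I \<Longrightarrow> norm (\<phi> t) > 0"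
  using away \<delta>_pos by force

lemma N_pos: "t \<in> I \<Longrightarrow> N t > 0"
  using norm_pos by (simp add: N_norm)

lemma q_pos: "t \<in> I \<Longrightarrow> q t > 0"
  using N_pos by (simp add: q_def)

lemma \<rho>_pos: "t \<in> I \<Longrightarrow> \<rho> t > 0"
  using norm_pos by (simp add: \<rho>_def)

lemma \<rho>_le: "t \<in> I \<Longrightarrow> \<rho> t \<le> 1 / \<delta>"
  using away \<delta>_pos by (simp add: \<rho>_def frac_le)

lemma q_\<rho>: "t \<in> I \<Longrightarrow> q t = 1 / \<rho> t ^ (2 * k)"
  by (simp add: q_def N_norm \<rho>_def power_mult power_divide)

lemma \<rho>_q: "t \<in> I \<Longrightarrow> \<rho> t ^ (2 * k) = 1 / q t"
  by (simp add: q_\<rho>)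

lemma convex_I: "convex I"
  using I_interval by (simp add: is_interval_convex)

lemma component_derivs:
  assumes "t \<in> I"
  shows "((\<lambda>t. fst (\<phi> t)) has_real_derivative (- snd (\<phi> t) + fst (\<phi> t) * (1 / q t + a))) (at t within I)"
    and "((\<lambda>t. snd (\<phi> t)) has_real_derivative (fst (\<phi> t) + snd (\<phi> t) * (1 / q t + a))) (at t within I)"
proof -
  have f: "hopf_inv_field k a (\<phi> t) =
      (- snd (\<phi> t) + fst (\<phi> t) * (1 / q t + a), fst (\<phi> t) + snd (\<phi> t) * (1 / q t + a))"
    by (simp add: hopf_inv_field_def Let_def q_def N_def)
  have "((\<lambda>t. fst (\<phi> t)) has_vector_derivative fst (hopf_inv_field k a (\<phi> t))) (at t within I)"
    by (rule bounded_linear.has_vector_derivative[OF bounded_linear_fst solution[OF assms]])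
  then show "((\<lambda>t. fst (\<phi> t)) has_real_derivative (- snd (\<phi> t) + fst (\<phi> t) * (1 / q t + a))) (at t within I)"
    unfolding f has_real_derivative_iff_has_vector_derivative by simp
  have "((\<lambda>t. snd (\<phi> t)) has_vector_derivative snd (hopf_inv_field k a (\<phi> t))) (at t within I)"
    by (rule bounded_linear.has_vector_derivative[OF bounded_linear_snd solution[OF assms]])
  then show "((\<lambda>t. snd (\<phi> t)) has_real_derivative (fst (\<phi> t) + snd (\<phi> t) * (1 / q t + a))) (at t within I)"
    unfolding f has_real_derivative_iff_has_vector_derivative by simp
qed

lemma N_deriv:
  assumes "t \<in> I"
  shows "(N has_real_derivative 2 * N t * (1 / q t + a)) (at t within I)"
proof -
  note [derivative_intros] = component_derivs[OF assms]
  show ?thesis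
    unfolding N_def[abs_def]
    by (auto intro!: derivative_eq_intros) (simp add: algebra_simps power2_eq_square)
qed

lemma q_deriv:
  assumes "t \<in> I"
  shows "(q has_real_derivative 2 * real k * (1 + a * q t)) (at t within I)"
proof -
  have "((\<lambda>t. N t ^ k) has_real_derivative real k * (2 * N t * (1 / q t + a)) * N t ^ (k - 1)) (at t within I)"
    by (rule derivative_eq_intros N_deriv[OF assms] refl)+ (simp add: mult_ac)
  also have "real k * (2 * N t * (1 / q t + a)) * N t ^ (k - 1) = 2 * real k * (1 / q t + a) * (N t * N t ^ (k - 1))"
    by (simp add: mult_ac)
  also have "N t * N t ^ (k - 1) = q t"
    using k_pos unfolding q_def by (cases k) auto
  also have "2 * real k * (1 / q t + a) * q t = 2 * real k * (1 + a * q t)"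
    using q_pos[OF assms] by (simp add: field_simps)
  finally show ?thesis unfolding q_def[abs_def] .
qed

lemma \<rho>_deriv:
  assumes "t \<in> I"
  shows "(\<rho> has_real_derivative - \<rho> t * (1 / q t + a)) (at t within I)"
proof -
  have r: "\<rho> = (\<lambda>t. inverse (sqrt (N t)))"
    by (rule ext) (simp add: \<rho>_def N_norm inverse_eq_divide)
  show ?thesis
    unfolding r using N_pos[OF assms]
    by (auto intro!: derivative_eq_intros N_deriv[OF assms])
       (simp add: field_simps real_sqrt_mult[symmetric])
qed

text \<open>The pair \<open>(c, s)\<close> is the unit vector in direction \<open>\<phi> t\<close>
  turned back by the angle \<open>t\<close>. The field turns with angular speed 1, so the pair is
  constant, and the angle of this constant vector is \<open>\<theta>0\<close>. No branch of the
  argument has to be chosen.\<close>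

lemma angle_linear: "\<exists>\<theta>0. \<forall>t\<in>I. inversion (\<phi> t) = polar (\<rho> t) (t + \<theta>0)"
proof -
  define c where "c t = \<rho> t * (fst (\<phi> t) * cos t + snd (\<phi> t) * sin t)" for t
  define s where "s t = \<rho> t * (snd (\<phi> t) * cos t - fst (\<phi> t) * sin t)" for t
  have "(c has_real_derivative 0) (at t within I)" "(s has_real_derivative 0) (at t within I)" if "t \<in> I" for t
  proof -
    note [derivative_intros] = component_derivs[OF that] \<rho>_deriv[OF that]
    show "(c has_real_derivative 0) (at t within I)"
      unfolding c_def[abs_def] by (auto intro!: derivative_eq_intros) (simp add: algebra_simps)
    show "(s has_real_derivative 0) (at t within I)"
      unfolding s_def[abs_def] by (auto intro!: derivative_eq_intros) (simp add: algebra_simps)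
  qed
  then obtain c0 s0 where cs: "\<And>t. t \<in> I \<Longrightarrow> c t = c0" "\<And>t. t \<in> I \<Longrightarrow> s t = s0"
    using has_field_derivative_zero_constant[OF convex_I, of c] has_field_derivative_zero_constant[OF convex_I, of s]
    by metis
  obtain t0 where t0: "t0 \<in> I"
    using unbounded by (metis bounded_empty empty_iff equals0I image_empty)
  have "(c t)\<^sup>2 + (s t)\<^sup>2 = (\<rho> t)\<^sup>2 * N t * ((sin t)\<^sup>2 + (cos t)\<^sup>2)" for t
    unfolding c_def s_def N_def by algebra
  then have "(c t0)\<^sup>2 + (s t0)\<^sup>2 = 1"
    using norm_pos[OF t0] by (simp add: \<rho>_def N_norm power_divide)
  then obtain \<theta>0 where th: "c0 = cos \<theta>0" "s0 = sin \<theta>0"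
    using sincos_total_2pi cs[OF t0] by metis
  have "inversion (\<phi> t) = polar (\<rho> t) (t + \<theta>0)" if t: "t \<in> I" for t
  proof -
    have "cos t * c t - sin t * s t = \<rho> t * fst (\<phi> t) * ((sin t)\<^sup>2 + (cos t)\<^sup>2)"
      "sin t * c t + cos t * s t = \<rho> t * snd (\<phi> t) * ((sin t)\<^sup>2 + (cos t)\<^sup>2)"
      unfolding c_def s_def by algebra+
    then have "cos (t + \<theta>0) = \<rho> t * fst (\<phi> t)" "sin (t + \<theta>0) = \<rho> t * snd (\<phi> t)"
      using cs[OF t] th by (simp_all add: cos_add sin_add add.commute mult.commute)
    then have "polar (\<rho> t) (t + \<theta>0) = ((\<rho> t)\<^sup>2) *\<^sub>R \<phi> t"
      by (simp add: polar_def power2_eq_square scaleR_prod_def)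
    then show ?thesis
      by (simp add: inversion_def \<rho>_def power_divide)
  qed
  then show ?thesis by blast
qed

lemma q_unbounded: "\<exists>t\<in>I. q t > M"
proof -
  obtain t where t: "t \<in> I" "norm (\<phi> t) > \<bar>M\<bar> + 1"
    using unbounded unfolding bounded_iff by (metis imageE not_le)
  have "\<bar>M\<bar> + 1 \<le> (\<bar>M\<bar> + 1) ^ (2 * k)"
    using k_pos by (intro self_le_power) auto
  also have "\<dots> \<le> norm (\<phi> t) ^ (2 * k)"
    using t by (intro power_mono) auto
  also have "\<dots> = q t" by (simp add: q_def N_norm power_mult)
  finally show ?thesis using t(1) by (intro bexI[of _ t]) auto
qed

lemma \<rho>_small: "e > 0 \<Longrightarrow> \<exists>t\<in>I. \<rho> t < e"
proof -
  assume e: "e > 0"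
  obtain t where t: "t \<in> I" "norm (\<phi> t) > 1 / e"
    using unbounded unfolding bounded_iff by (metis imageE not_le)
  then have "\<rho> t < e"
    using e norm_pos[OF t(1)] by (simp add: \<rho>_def field_simps)
  with t show ?thesis by blast
qed

lemma q_affine:
  assumes "a = 0"
  obtains c where "\<And>t. t \<in> I \<Longrightarrow> q t = 2 * real k * t + c"
proof -
  have "((\<lambda>t. q t - 2 * real k * t) has_real_derivative 0) (at t within I)" if "t \<in> I" for t
    using q_deriv[OF that] assms by (auto intro!: derivative_eq_intros)
  then obtain c where c: "\<forall>t\<in>I. q t - 2 * real k * t = c"
    using has_field_derivative_zero_constant[OF convex_I, of "\<lambda>t. q t - 2 * real k * t"] by blast
  show ?thesis
  proof (rule that)
    fix t assume "t \<in> I"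
    then have "q t - 2 * real k * t = c" using c by blast
    then show "q t = 2 * real k * t + c" by simp
  qed
qed

text \<open>The product of \<open>1 + a * q t\<close> with
  \<open>exp (- (2 * real k * a * t))\<close> is a constant \<open>C\<close>. Unboundedness makes
  \<open>C\<close> nonzero with the sign of \<open>a\<close>; for \<open>a < 0\<close> this places
  the inverted orbit strictly inside the limit cycle.\<close>

lemma q_exp:
  assumes "a \<noteq> 0"
  obtains P where "P > 0" "\<And>t. t \<in> I \<Longrightarrow> \<bar>1 + a * q t\<bar> = P * exp (2 * real k * a * t)"
    "\<And>t. t \<in> I \<Longrightarrow> 1 + a * q t = sgn a * \<bar>1 + a * q t\<bar>"
proof -
  let ?f = "\<lambda>t. (1 + a * q t) * exp (- (2 * real k * a * t))"
  have "(?f has_real_derivative 0) (at t within I)" if "t \<in> I" for t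
    by (auto intro!: derivative_eq_intros q_deriv[OF that])
  then obtain C where C: "\<forall>t\<in>I. ?f t = C"
    using has_field_derivative_zero_constant[OF convex_I, of ?f] by blast
  have eq: "1 + a * q t = C * exp (2 * real k * a * t)" if "t \<in> I" for t
  proof -
    have "C * exp (2 * real k * a * t) = (1 + a * q t) * (exp (- (2 * real k * a * t)) * exp (2 * real k * a * t))"
      using C that by (metis mult.assoc)
    then show ?thesis by (simp add: exp_add[symmetric])
  qed
  \<comment> \<open>Beyond \<open>1 / \<bar>a\<bar>\<close> the term \<open>a * q\<close> outweighs
    1 and fixes the sign.\<close>
  obtain t0 where t0: "t0 \<in> I" "q t0 > 1 / \<bar>a\<bar>" using q_unbounded by blast
  then have "1 < \<bar>a\<bar> * q t0" using assms by (simp add: field_simps)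
  then have "sgn a * (1 + a * q t0) > 0"
    using assms by (cases "a > 0") (auto simp: sgn_if)
  then have "sgn a * C * exp (2 * real k * a * t0) > 0"
    unfolding eq[OF t0(1)] by (simp add: mult_ac)
  then have sC: "sgn a * C > 0" by (simp add: zero_less_mult_iff)
  then have C': "sgn C = sgn a" "\<bar>C\<bar> > 0"
    using assms by (auto simp: sgn_if split: if_splits)
  show ?thesis
  proof (rule that[of "\<bar>C\<bar>"])
    show "\<bar>C\<bar> > 0" by fact
    fix t assume t: "t \<in> I"
    show "\<bar>1 + a * q t\<bar> = \<bar>C\<bar> * exp (2 * real k * a * t)"
      unfolding eq[OF t] by (simp add: abs_mult)
    show "1 + a * q t = sgn a * \<bar>1 + a * q t\<bar>"
      unfolding eq[OF t] C'(1)[symmetric] by (simp add: abs_mult sgn_mult_abs mult.assoc[symmetric])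
  qed
qed

section \<open>Lower and upper bounds for the neighbourhood area of an orbit\<close>

text \<open>The image of the interval under the continuous radius is connected, and it contains
  arbitrarily small radii because the original orbit is unbounded.\<close>

lemma \<rho>_IVT:
  assumes t1: "t1 \<in> I" and r: "0 < r" "r \<le> \<rho> t1"
  obtains t where "t \<in> I" "\<rho> t = r"
proof -
  obtain t2 where t2: "t2 \<in> I" "\<rho> t2 < r" using \<rho>_small[OF r(1)] by blast
  have "continuous_on I \<rho>"
    unfolding continuous_on_eq_continuous_within using \<rho>_deriv DERIV_continuous by blast
  then have "connected (\<rho> ` I)"
    using connected_continuous_image convex_connected convex_I by blast
  moreover have "\<rho> t2 \<in> \<rho> ` I" "\<rho> t1 \<in> \<rho> ` I" using t1 t2 by auto
  ultimately have "r \<in> \<rho> ` I"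
    using t2 r connectedD_interval[of "\<rho> ` I" "\<rho> t2" "\<rho> t1" r] by auto
  then show ?thesis using that by blast
qed

lemma orbit_bounded: "bounded ((\<lambda>t. polar (\<rho> t) (t + \<theta>0)) ` I)"
  unfolding bounded_iff
proof (intro exI ballI)
  fix p assume "p \<in> (\<lambda>t. polar (\<rho> t) (t + \<theta>0)) ` I"
  then obtain t where "t \<in> I" "p = polar (\<rho> t) (t + \<theta>0)" by auto
  then show "norm p \<le> 1 / \<delta>" using \<rho>_pos[of t] \<rho>_le[of t] by simp
qed

text \<open>Each circle of radius between \<open>r0 / 2\<close> and \<open>r0\<close> meets the
  orbit, and around the meeting point an arc of half-angle \<open>e / r\<close> lies in the
  neighbourhood. Integrating \<open>r\<close> times \<open>2 * e / r\<close> over these radii gives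
  \<open>r0 * e\<close>.\<close>

lemma nbhd_measure_linear_lower:
  "\<exists>c>0. \<forall>\<^sub>F e in at_right 0. c * e \<le> measure lborel (eps_nbhd ((\<lambda>t. polar (\<rho> t) (t + \<theta>0)) ` I) e)"
proof -
  let ?S = "(\<lambda>t. polar (\<rho> t) (t + \<theta>0)) ` I"
  obtain t1 where t1: "t1 \<in> I" using q_unbounded by blast
  define r0 where "r0 = \<rho> t1"
  have r0: "r0 > 0" using \<rho>_pos[OF t1] by (simp add: r0_def)
  \<comment> \<open>For such \<open>e\<close> the arc of angle \<open>2 * e / r\<close> is at most a
    full turn, down to \<open>r = r0 / 2\<close>.\<close>
  have "\<forall>\<^sub>F e in at_right 0. 0 < e \<and> e < pi * r0 / 2"
    using eventually_at_right_real[of 0 "pi * r0 / 2"] r0 by simp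
  then have "\<forall>\<^sub>F e in at_right 0. r0 * e \<le> measure lborel (eps_nbhd ?S e)"
  proof eventually_elim
    case (elim e)
    have "((\<lambda>r. 2 * e) has_integral r0 * e) {r0 / 2..r0}"
      using has_integral_const_real[of "2 * e" "r0 / 2" r0] r0 by (simp add: field_simps)
    then have WI: "((\<lambda>r. r * (2 * e / r)) has_integral r0 * e) {r0 / 2..r0}"
      by (rule has_integral_eq[rotated]) (use r0 in auto)
    show ?case
    proof (rule polar_integral_le_measure[OF borel_eps_nbhd emeasure_eps_nbhd_finite[OF orbit_bounded] _ _ _ WI])
      fix r assume r: "r \<in> {r0 / 2..r0}"
      then show "0 \<le> 2 * e / r" using elim r0 by auto
      have rp: "0 < r" using r r0 by auto
      obtain t where t: "t \<in> I" "\<rho> t = r" using \<rho>_IVT[OF t1 rp] r by (auto simp: r0_def)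
      have "pi * (r0 / 2) \<le> pi * r" using r by (intro mult_left_mono) auto
      then have "2 * e < 2 * pi * r" using elim by linarith
      then have "2 * e / r \<le> 2 * pi" using rp by (simp add: pos_divide_le_eq)
      then have "ennreal (2 * e / r) = ennreal (min (2 * pi) ((t + \<theta>0 + e / r) - (t + \<theta>0 - e / r)))"
        by simp
      also have "\<dots> \<le> emeasure lborel {\<theta>\<in>{0..<2*pi}. polar r \<theta> \<in> eps_nbhd ?S e}"
      proof (rule angular_lower[OF borel_eps_nbhd])
        fix \<theta> assume "t + \<theta>0 - e / r < \<theta>" "\<theta> < t + \<theta>0 + e / r"
        then have "\<bar>\<theta> - (t + \<theta>0)\<bar> < e / r" by linarith
        then have "r * \<bar>\<theta> - (t + \<theta>0)\<bar> < e" using rp by (simp add: field_simps)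
        then have "dist (polar r \<theta>) (polar (\<rho> t) (t + \<theta>0)) < e"
          using dist_polar_same_radius[of r \<theta> "t + \<theta>0"] rp t by simp
        then show "polar r \<theta> \<in> eps_nbhd ?S e" using t(1) unfolding eps_nbhd_def by blast
      qed
      finally show "ennreal (2 * e / r) \<le> emeasure lborel {\<theta>\<in>{0..<2*pi}. polar r \<theta> \<in> eps_nbhd ?S e}" .
    qed (use r0 in auto)
  qed
  with r0 show ?thesis by blast
qed

text \<open>The radial speed \<open>\<rho> * \<bar>1 / q + a\<bar>\<close> is bounded because
  \<open>1 / q = \<rho> ^ (2 * k)\<close> and \<open>\<rho> \<le> 1 / \<delta>\<close>; the angular
  speed is 1. The two motions are added through the point with the radius of time \<open>t\<close>
  and the angle of time \<open>s\<close>.\<close>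

lemma orbit_lipschitz:
  obtains V where "V > 0" "\<And>s t. s \<in> I \<Longrightarrow> t \<in> I \<Longrightarrow>
    dist (polar (\<rho> s) (s + \<theta>0)) (polar (\<rho> t) (t + \<theta>0)) \<le> V * \<bar>s - t\<bar>"
proof
  let ?V1 = "1 / \<delta> * ((1 / \<delta>) ^ (2 * k) + \<bar>a\<bar>)"
  show "?V1 + 1 / \<delta> > 0" using \<delta>_pos by (intro add_nonneg_pos mult_nonneg_nonneg) auto
  fix s t assume st: "s \<in> I" "t \<in> I"
  have "norm (\<rho> s - \<rho> t) \<le> ?V1 * norm (s - t)"
  proof (rule field_differentiable_bound[OF convex_I \<rho>_deriv _ st])
    fix z assume z: "z \<in> I"
    have "\<bar>1 / q z + a\<bar> \<le> \<bar>\<rho> z ^ (2 * k)\<bar> + \<bar>a\<bar>" unfolding \<rho>_q[OF z] by (rule abs_triangle_ineq)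
    also have "\<dots> \<le> (1 / \<delta>) ^ (2 * k) + \<bar>a\<bar>"
      using \<rho>_pos[OF z] \<rho>_le[OF z] by (simp add: power_mono del: power_divide)
    finally have "\<rho> z * \<bar>1 / q z + a\<bar> \<le> ?V1"
      using \<rho>_pos[OF z] \<rho>_le[OF z] \<delta>_pos by (intro mult_mono) auto
    then show "norm (- \<rho> z * (1 / q z + a)) \<le> ?V1"
      using \<rho>_pos[OF z] by (simp add: abs_mult)
  qed
  then have 1: "dist (polar (\<rho> s) (s + \<theta>0)) (polar (\<rho> t) (s + \<theta>0)) \<le> ?V1 * \<bar>s - t\<bar>"
    by (simp only: dist_polar_same_angle real_norm_def)
  have "dist (polar (\<rho> t) (s + \<theta>0)) (polar (\<rho> t) (t + \<theta>0)) \<le> \<bar>\<rho> t\<bar> * \<bar>(s + \<theta>0) - (t + \<theta>0)\<bar>"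
    by (rule dist_polar_same_radius)
  also have "\<dots> \<le> 1 / \<delta> * \<bar>s - t\<bar>"
    using \<rho>_pos[OF st(2)] \<rho>_le[OF st(2)] \<delta>_pos by (intro mult_mono) auto
  finally show "dist (polar (\<rho> s) (s + \<theta>0)) (polar (\<rho> t) (t + \<theta>0)) \<le> (?V1 + 1 / \<delta>) * \<bar>s - t\<bar>"
    using 1 dist_triangle[of "polar (\<rho> s) (s + \<theta>0)" "polar (\<rho> t) (t + \<theta>0)" "polar (\<rho> t) (s + \<theta>0)"]
    unfolding distrib_right by linarith
qed

text \<open>If \<open>a < 0\<close>, the time interval may be unbounded above, and then the orbit has infinite length
  because it also winds onto the limit cycle \<open>1 + aq = 0\<close>.\<close>

lemma nbhd_measure_near_cycle:
  assumes a: "a < 0" and Re: "0 < R" "R ^ (2 * k) = - a" and e: "0 < e" "(R + 1) * e \<le> R"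
    and J: "J \<subseteq> I" "\<And>t. t \<in> J \<Longrightarrow> 1 + a * q t < 0 \<and> - e < 1 + a * q t"
  shows "measure lborel (eps_nbhd ((\<lambda>t. polar (\<rho> t) (t + \<theta>0)) ` J) e) \<le> 2 * pi * R * (R + 2) * e"
proof -
  let ?N = "eps_nbhd ((\<lambda>t. polar (\<rho> t) (t + \<theta>0)) ` J) e"
  \<comment> \<open>Multiplied by \<open>\<rho> ^ (2 * k)\<close>, the quantity
    \<open>1 + a * q\<close> becomes \<open>\<rho> ^ (2 * k) - R ^ (2 * k)\<close>, so the orbit
    stays just inside the cycle of radius \<open>R\<close>.\<close>
  have \<rho>_bounds: "\<rho> t < R" "R - R * e < \<rho> t" if t: "t \<in> J" for t
  proof -
    have tI: "t \<in> I" using t J(1) by auto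
    have x: "\<rho> t ^ (2 * k) > 0" using \<rho>_pos[OF tI] by simp
    have qx: "q t * \<rho> t ^ (2 * k) = 1" using q_\<rho>[OF tI] \<rho>_pos[OF tI] by simp
    have "(1 + a * q t) * \<rho> t ^ (2 * k) < 0" using J(2)[OF t] x by (simp add: mult_neg_pos)
    moreover have eq: "(1 + a * q t) * \<rho> t ^ (2 * k) = \<rho> t ^ (2 * k) + a"
      using qx by (simp add: algebra_simps)
    ultimately have lt: "\<rho> t ^ (2 * k) < R ^ (2 * k)" unfolding Re by linarith
    show 1: "\<rho> t < R" by (rule power_less_imp_less_base[OF lt]) (use Re in simp)
    have "- e * \<rho> t ^ (2 * k) < (1 + a * q t) * \<rho> t ^ (2 * k)"
      using J(2)[OF t] x by (intro mult_strict_right_mono) auto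
    then have "R ^ (2 * k) - \<rho> t ^ (2 * k) < e * \<rho> t ^ (2 * k)"
      unfolding eq Re by simp
    also have "\<dots> < e * R ^ (2 * k)" using lt e by simp
    finally have "R ^ (2 * k) - \<rho> t ^ (2 * k) < e * R ^ (2 * k)" .
    with power_diff_ge[of "\<rho> t" R "2 * k"] 1 \<rho>_pos[OF tI] k_pos
    have "R ^ (2 * k - 1) * (R - \<rho> t) < e * R ^ (2 * k)" by auto
    also have "e * R ^ (2 * k) = R ^ (2 * k - 1) * (R * e)"
      using k_pos by (cases k) (auto simp: mult_ac)
    finally show "R - R * e < \<rho> t" using Re by simp
  qed
  \<comment> \<open>The annulus between \<open>R - R * e\<close> and \<open>R\<close>, thickened by
    \<open>e\<close> on both sides; the assumption on \<open>(R + 1) * e\<close> keeps the inner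
    radius nonnegative.\<close>
  have "?N \<subseteq> ball 0 (R + e) - ball 0 (R - (R + 1) * e)"
  proof
    fix x assume "x \<in> ?N"
    then obtain t where t: "t \<in> J" "dist x (polar (\<rho> t) (t + \<theta>0)) < e" by (auto simp: eps_nbhd_def)
    have "\<bar>norm x - \<bar>\<rho> t\<bar>\<bar> < e"
      using t(2) norm_triangle_ineq3[of x "polar (\<rho> t) (t + \<theta>0)"] by (simp add: dist_norm)
    moreover have "\<bar>\<rho> t\<bar> = \<rho> t" using \<rho>_pos[of t] t J by auto
    ultimately show "x \<in> ball 0 (R + e) - ball 0 (R - (R + 1) * e)"
      using \<rho>_bounds[OF t(1)] by (auto simp: algebra_simps)
  qed
  then have "measure lborel ?N \<le> measure lborel (ball (0::real\<times>real) (R + e) - ball 0 (R - (R + 1) * e))"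
  proof (intro measure_mono_fmeasurable fmeasurableI)
    have "emeasure lborel (ball (0::real\<times>real) (R + e) - ball 0 (R - (R + 1) * e)) \<le> emeasure lborel (ball (0::real\<times>real) (R + e))"
      by (rule emeasure_mono) auto
    also have "\<dots> < \<infinity>" by (rule emeasure_lborel_ball_finite)
    finally show "emeasure lborel (ball (0::real\<times>real) (R + e) - ball 0 (R - (R + 1) * e)) < \<infinity>" .
  qed auto
  also have "\<dots> = measure lborel (ball (0::real\<times>real) (R + e)) - measure lborel (ball (0::real\<times>real) (R - (R + 1) * e))"
    by (rule measure_Diff)
       (use e Re emeasure_lborel_ball_finite[of "0::real\<times>real" "R + e"] in \<open>auto simp: algebra_simps intro!: subset_ball\<close>)
  also have "\<dots> = pi * (R + e)\<^sup>2 - pi * (R - (R + 1) * e)\<^sup>2"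
    using e Re by (simp add: measure_ball_plane)
  also have "\<dots> = 2 * pi * R * (R + 2) * e - pi * R * (R + 2) * e\<^sup>2"
    by (simp add: algebra_simps power2_eq_square)
  also have "\<dots> \<le> 2 * pi * R * (R + 2) * e" using Re by simp
  finally show ?thesis .
qed

text \<open>Times are split by the size of \<open>p = \<bar>1 + a * q\<bar>\<close>: large
  \<open>p\<close> means close to the origin, small \<open>p\<close> close to the limit cycle. In
  between, \<open>ln p\<close> is affine in time, so the time span is \<open>O(ln (1 / e))\<close>
  and the Lipschitz covering applies; \<open>e powr (- h)\<close> absorbs the logarithm.\<close>

lemma nbhd_measure_upper:
  assumes a: "a \<noteq> 0" and h: "h > 0"
  shows "\<exists>K. \<forall>\<^sub>F e in at_right 0.
    measure lborel (eps_nbhd ((\<lambda>t. polar (\<rho> t) (t + \<theta>0)) ` I) e) \<le> K * e powr (1 - h)"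
proof -
  let ?y = "\<lambda>t. polar (\<rho> t) (t + \<theta>0)"
  obtain P where P: "P > 0" "\<And>t. t \<in> I \<Longrightarrow> \<bar>1 + a * q t\<bar> = P * exp (2 * real k * a * t)"
    and sg: "\<And>t. t \<in> I \<Longrightarrow> 1 + a * q t = sgn a * \<bar>1 + a * q t\<bar>"
    using q_exp[OF a] by blast
  obtain V where V: "V > 0" "\<And>s t. s \<in> I \<Longrightarrow> t \<in> I \<Longrightarrow> dist (?y s) (?y t) \<le> V * \<bar>s - t\<bar>"
    using orbit_lipschitz by blast
  define p where "p t = \<bar>1 + a * q t\<bar>" for t
  define R where "R = root (2 * k) \<bar>a\<bar>"
  have R: "R > 0" "R ^ (2 * k) = \<bar>a\<bar>" using a k_pos by (simp_all add: R_def)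
  have ka: "2 * real k * \<bar>a\<bar> > 0" using a k_pos by simp
  \<comment> \<open>Comes from
    \<open>M / e \<le> (\<bar>a\<bar> + 1) * (1 / e) ^ (2 * k + 1)\<close> together with
    \<open>ln (1 / e) \<le> e powr (- h) / h\<close>.\<close>
  define C where "C = (ln (\<bar>a\<bar> + 1) + (2 * real k + 1) / h) / (2 * real k * \<bar>a\<bar>)"
  \<comment> \<open>The bound \<open>R / (R + 1)\<close> yields the condition
    \<open>(R + 1) * e \<le> R\<close> of the estimate near the cycle.\<close>
  define b where "b = min 1 (R / (R + 1))"
  have b: "b > 0" using R by (simp add: b_def)
  define K where "K = 8 * pi * C * V + 8 * pi + 2 * pi * R * (R + 2)"
  have "\<forall>\<^sub>F e in at_right 0. 0 < e \<and> e < b"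
    using eventually_at_right_real[OF b] by simp
  then have "\<forall>\<^sub>F e in at_right 0. measure lborel (eps_nbhd (?y ` I) e) \<le> K * e powr (1 - h)"
  proof eventually_elim
    case (elim e)
    then have e: "0 < e" "e < 1" "e < R / (R + 1)" by (auto simp: b_def)
    \<comment> \<open>Chosen so that \<open>p t > M\<close> forces
      \<open>q t > 1 / e ^ (2 * k)\<close>, that is \<open>\<rho> t < e\<close>.\<close>
    define M where "M = \<bar>a\<bar> / e ^ (2 * k) + 1"
    define \<Lambda> where "\<Lambda> = ln (M / e) / (2 * real k * \<bar>a\<bar>)"
    define J where "J = {t \<in> I. e \<le> p t \<and> p t \<le> M}"
    define J2 where "J2 = {t \<in> I. p t > M}"
    define J3 where "J3 = {t \<in> I. p t < e}"
    have M1: "M \<ge> 1" using e by (simp add: M_def)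
    have \<Lambda>0: "\<Lambda> \<ge> 0" unfolding \<Lambda>_def using ka M1 e by (intro divide_nonneg_nonneg ln_ge_zero) (auto simp: field_simps)
    have h1: "1 \<le> e powr (- h)" using e h by (simp add: powr_minus field_simps powr_le1)
    have \<Lambda>C: "\<Lambda> \<le> C * e powr (- h)"
    proof -
      have "e ^ (2 * k) \<le> 1" using e by (simp add: power_le_one)
      then have "M \<le> (\<bar>a\<bar> + 1) / e ^ (2 * k)" unfolding M_def using e by (simp add: field_simps)
      then have "M / e \<le> (\<bar>a\<bar> + 1) / e ^ (2 * k) / e" using e by (intro divide_right_mono) auto
      also have "\<dots> = (\<bar>a\<bar> + 1) * (1 / e) ^ (2 * k + 1)" by (simp add: power_divide)
      finally have "ln (M / e) \<le> ln ((\<bar>a\<bar> + 1) * (1 / e) ^ (2 * k + 1))"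
        using M1 e by (subst ln_le_cancel_iff) (auto intro!: mult_pos_pos)
      also have "\<dots> = ln (\<bar>a\<bar> + 1) + ln ((1 / e) ^ (2 * k + 1))"
        using e by (intro ln_mult_pos) auto
      also have "ln ((1 / e) ^ (2 * k + 1)) = (2 * real k + 1) * ln (1 / e)"
        using e by (subst ln_realpow) auto
      also have "ln (1 / e) \<le> (1 / e) powr h / h"
        using e h by (intro ln_powr_bound) auto
      also have "(1 / e) powr h = e powr (- h)"
        using e by (simp add: powr_minus powr_divide inverse_eq_divide)
      finally have "ln (M / e) \<le> ln (\<bar>a\<bar> + 1) + (2 * real k + 1) * (e powr (- h) / h)"
        by (simp add: mult_left_mono)
      also have "ln (\<bar>a\<bar> + 1) \<le> ln (\<bar>a\<bar> + 1) * e powr (- h)"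
        using h1 by (simp add: mult_le_cancel_left1 ln_ge_zero)
      finally have "ln (M / e) \<le> (ln (\<bar>a\<bar> + 1) + (2 * real k + 1) / h) * e powr (- h)"
        by (simp add: distrib_right)
      then show ?thesis unfolding \<Lambda>_def C_def using ka
        by (simp add: divide_right_mono)
    qed
    have diam: "\<bar>s - t\<bar> \<le> \<Lambda>" if "s \<in> J" "t \<in> J" for s t
    proof -
      have lnp: "ln (p t) = ln P + 2 * real k * a * t" "ln e \<le> ln (p t)" "ln (p t) \<le> ln M" if "t \<in> J" for t
      proof -
        have t: "t \<in> I" "e \<le> p t" "p t \<le> M" using that by (auto simp: J_def)
        show "ln (p t) = ln P + 2 * real k * a * t"
          unfolding p_def P(2)[OF t(1)] using P(1) by (simp add: ln_mult_pos)
        show "ln e \<le> ln (p t)" "ln (p t) \<le> ln M" using t e by auto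
      qed
      have "\<bar>2 * real k * a * s - 2 * real k * a * t\<bar> \<le> ln M - ln e"
        using lnp[OF that(1)] lnp[OF that(2)] by linarith
      also have "\<bar>2 * real k * a * s - 2 * real k * a * t\<bar> = 2 * real k * \<bar>a\<bar> * \<bar>s - t\<bar>"
        by (simp add: right_diff_distrib[symmetric] abs_mult)
      also have "ln M - ln e = ln (M / e)" using M1 e by (simp add: ln_div)
      finally show ?thesis unfolding \<Lambda>_def using ka by (simp add: pos_le_divide_eq mult.commute)
    qed
    \<comment> \<open>Times at mutual distance at most \<open>\<Lambda>\<close> lie in the interval
      of radius \<open>\<Lambda>\<close> around any one of them.\<close>
    have "\<exists>u. J \<subseteq> {u..u + 2 * \<Lambda>}"
    proof (cases "J = {}")
      case False
      then obtain s where "s \<in> J" by blast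
      then have "J \<subseteq> {s - \<Lambda>..(s - \<Lambda>) + 2 * \<Lambda>}" using diam[of s] by (force simp: abs_le_iff)
      then show ?thesis by blast
    qed simp
    then obtain u where u: "J \<subseteq> {u..u + 2 * \<Lambda>}" by blast
    have m1: "measure lborel (eps_nbhd (?y ` J) e) \<le> 4 * pi * (2 * \<Lambda> * V * e + e\<^sup>2)"
      by (rule measure_nbhd_lipschitz_image[OF _ u V(1) e(1)]) (use V(2) \<Lambda>0 in \<open>auto simp: J_def\<close>)
    have "eps_nbhd (?y ` J2) e \<subseteq> ball 0 (2 * e)"
    proof
      fix x assume "x \<in> eps_nbhd (?y ` J2) e"
      then obtain t where t: "t \<in> I" "p t > M" "dist x (?y t) < e" by (auto simp: eps_nbhd_def J2_def)
      have "p t \<le> 1 + \<bar>a\<bar> * q t"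
        using abs_triangle_ineq[of 1 "a * q t"] q_pos[OF t(1)] by (simp add: p_def abs_mult)
      with t(2) have "\<bar>a\<bar> * (1 / e ^ (2 * k)) < \<bar>a\<bar> * q t" unfolding M_def by simp
      then have "1 / e ^ (2 * k) < q t"
        by (rule mult_left_less_imp_less) simp
      then have "1 / e ^ (2 * k) < 1 / \<rho> t ^ (2 * k)" using q_\<rho>[OF t(1)] by simp
      then have "\<rho> t ^ (2 * k) < e ^ (2 * k)" using \<rho>_pos[OF t(1)] e by (simp add: field_simps)
      then have "\<rho> t < e" by (rule power_less_imp_less_base) (use e in simp)
      then show "x \<in> ball 0 (2 * e)"
        using t(3) norm_triangle_ineq2[of x "?y t"] \<rho>_pos[OF t(1)] by (simp add: dist_norm)
    qed
    then have "measure lborel (eps_nbhd (?y ` J2) e) \<le> measure lborel (ball (0::real\<times>real) (2 * e))"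
      by (intro measure_mono_fmeasurable fmeasurableI emeasure_lborel_ball_finite) auto
    also have "\<dots> = 4 * pi * e\<^sup>2" using e by (simp add: measure_ball_plane)
    finally have m2: "measure lborel (eps_nbhd (?y ` J2) e) \<le> 4 * pi * e\<^sup>2" .
    have m3: "measure lborel (eps_nbhd (?y ` J3) e) \<le> 2 * pi * R * (R + 2) * e"
    proof (cases "a > 0")
      \<comment> \<open>For \<open>a > 0\<close> there is no limit cycle:
        \<open>p \<ge> 1 > e\<close> throughout.\<close>
      case True
      have "J3 = {}"
      proof -
        have "p t \<ge> 1" if "t \<in> I" for t
          using True q_pos[OF that] by (simp add: p_def)
        then show ?thesis using e unfolding J3_def by force
      qed
      then show ?thesis using R e by (simp add: eps_nbhd_def)
    next
      case False
      then have an: "a < 0" using a by simp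
      show ?thesis
      proof (rule nbhd_measure_near_cycle[OF an R(1) _ e(1)])
        show "R ^ (2 * k) = - a" using R an by simp
        show "(R + 1) * e \<le> R" using e(3) R by (simp add: field_simps)
        show "J3 \<subseteq> I" by (auto simp: J3_def)
        fix t assume "t \<in> J3"
        then have t: "t \<in> I" "p t < e" by (auto simp: J3_def)
        have "p t > 0" using P t(1) by (simp add: p_def)
        moreover have "1 + a * q t = - p t" using sg[OF t(1)] an by (simp add: p_def)
        ultimately show "1 + a * q t < 0 \<and> - e < 1 + a * q t" using t by linarith
      qed
    qed
    have I: "?y ` I = (?y ` J \<union> ?y ` J2) \<union> ?y ` J3"
      unfolding image_Un[symmetric] by (rule arg_cong[where f = "(`) ?y"]) (auto simp: J_def J2_def J3_def)
    have "measure lborel (eps_nbhd (?y ` I) e) \<le>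
       (measure lborel (eps_nbhd (?y ` J) e) + measure lborel (eps_nbhd (?y ` J2) e)) + measure lborel (eps_nbhd (?y ` J3) e)"
      unfolding I eps_nbhd_Un
      by (rule order.trans[OF measure_Un_le]) (auto intro!: measure_Un_le)
    also have "\<dots> \<le> 4 * pi * (2 * \<Lambda> * V * e + e\<^sup>2) + 4 * pi * e\<^sup>2 + 2 * pi * R * (R + 2) * e"
      using m1 m2 m3 by linarith
    also have "\<dots> = 8 * pi * V * (\<Lambda> * e) + 8 * pi * e\<^sup>2 + 2 * pi * R * (R + 2) * e"
      by (simp add: algebra_simps)
    also have "\<dots> \<le> 8 * pi * V * (C * e powr (1 - h)) + 8 * pi * e powr (1 - h) + 2 * pi * R * (R + 2) * e powr (1 - h)"
    proof -
      have ep: "e powr (1 - h) = e * e powr (- h)" using e powr_add[of e 1 "- h"] by simp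
      have "e \<le> e powr (1 - h)" unfolding ep using h1 e by (simp add: mult_le_cancel_left1)
      moreover have "e\<^sup>2 \<le> e" using e by (simp add: power2_eq_square mult_le_cancel_left2)
      moreover have "\<Lambda> * e \<le> C * e powr (1 - h)"
        unfolding ep using mult_right_mono[OF \<Lambda>C, of e] e by (simp add: mult_ac)
      ultimately show ?thesis using V(1) R
        by (intro add_mono mult_left_mono) auto
    qed
    also have "\<dots> = K * e powr (1 - h)" by (simp add: K_def algebra_simps)
    finally show ?case .
  qed
  then show ?thesis by blast
qed

section \<open>Box dimension and Minkowski measurability of the orbits\<close>

lemma box_dim_hyperbolic:
  assumes a: "a \<noteq> 0"
  shows "upper_box_dim ((\<lambda>t. polar (\<rho> t) (t + \<theta>0)) ` I) = 1"
    and "lower_box_dim ((\<lambda>t. polar (\<rho> t) (t + \<theta>0)) ` I) = 1"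
proof -
  let ?S = "(\<lambda>t. polar (\<rho> t) (t + \<theta>0)) ` I"
  obtain c where c: "c > 0" "\<forall>\<^sub>F e in at_right 0. c * e \<le> measure lborel (eps_nbhd ?S e)"
    using nbhd_measure_linear_lower by blast
  have ev0: "\<forall>\<^sub>F e in at_right 0. (0::real) < e"
    by (simp add: eventually_at_right_less)
  from c(2) ev0 have low: "\<forall>\<^sub>F e in at_right 0. c * e powr (2 - 1) \<le> measure lborel (eps_nbhd ?S e)"
    by eventually_elim simp
  have up: "((\<lambda>e. measure lborel (eps_nbhd ?S e) / e powr (2 - s)) \<longlongrightarrow> 0) (at_right 0)" if s: "s > 1" for s
  proof -
    \<comment> \<open>Half of the excess of \<open>s\<close> over 1 pays for the logarithm; the
      other half leaves the factor \<open>e powr h\<close> that tends to 0.\<close>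
    define h where "h = (s - 1) / 2"
    have h: "h > 0" using s by (simp add: h_def)
    obtain K where K: "\<forall>\<^sub>F e in at_right 0. measure lborel (eps_nbhd ?S e) \<le> K * e powr (1 - h)"
      using nbhd_measure_upper[OF a h] by blast
    have "((\<lambda>e. e powr h) \<longlongrightarrow> 0) (at_right (0::real))"
      using h by (intro tendsto_zero_powrI[where b = h] tendsto_const tendsto_ident_at)
         (auto simp: eventually_at_filter)
    from tendsto_mult[OF tendsto_const[of K] this]
    have lim: "((\<lambda>e. K * e powr h) \<longlongrightarrow> 0) (at_right 0)" by simp
    show ?thesis
    proof (rule tendsto_sandwich[OF _ _ tendsto_const lim])
      show "\<forall>\<^sub>F e in at_right 0. 0 \<le> measure lborel (eps_nbhd ?S e) / e powr (2 - s)"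
        by (simp add: eventually_mono[OF ev0])
      show "\<forall>\<^sub>F e in at_right 0. measure lborel (eps_nbhd ?S e) / e powr (2 - s) \<le> K * e powr h"
        using ev0 K
      proof eventually_elim
        case (elim e)
        have "e powr h * e powr (2 - s) = e powr (h + (2 - s))" by (simp add: powr_add)
        also have "h + (2 - s) = 1 - h" by (simp add: h_def field_simps)
        finally have "e powr (1 - h) = e powr h * e powr (2 - s)" by simp
        with elim show ?case by (simp add: pos_divide_le_eq mult.assoc)
      qed
    qed
  qed
  show "upper_box_dim ?S = 1" "lower_box_dim ?S = 1"
    using box_dim_eqI[OF c(1) low up] by auto
qed

lemma minkowski_weak_focus:
  assumes a: "a = 0"
  shows "upper_box_dim ((\<lambda>t. polar (\<rho> t) (t + \<theta>0)) ` I) = 4 * real k / (2 * real k + 1)"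
    and "lower_box_dim ((\<lambda>t. polar (\<rho> t) (t + \<theta>0)) ` I) = 4 * real k / (2 * real k + 1)"
    and "minkowski_measurable ((\<lambda>t. polar (\<rho> t) (t + \<theta>0)) ` I)"
proof -
  obtain c where c: "\<And>t. t \<in> I \<Longrightarrow> q t = 2 * real k * t + c"
    using q_affine[OF a] by blast
  obtain t0 where t0: "t0 \<in> I" using q_unbounded by blast
  have k: "2 * real k > 0" using k_pos by simp
  \<comment> \<open>As \<open>q\<close> is affine in time with positive slope, its unboundedness
    means arbitrarily late times in \<open>I\<close>; being an interval, \<open>I\<close> contains
    everything after \<open>t0\<close>.\<close>
  have "{t0..} \<subseteq> I"
  proof
    fix t assume t: "t \<in> {t0..}"
    obtain t1 where t1: "t1 \<in> I" "q t1 > 2 * real k * t + c" using q_unbounded by blast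
    then have "2 * real k * t < 2 * real k * t1" using c[OF t1(1)] by simp
    then have "t < t1" using k by simp
    then show "t \<in> I" using t by (intro mem_is_interval_1_I[OF I_interval t0 t1(1)]) auto
  qed
  then interpret power_spiral k \<rho> I c \<theta>0 "1 / \<delta>" t0
    using k_pos \<rho>_pos \<rho>_le q_\<rho> c t0 by unfold_locales auto
  have "(pi + 2 * pi / (2 * real k - 1)) / pi powr (2 / (2 * real k + 1)) > 0"
    using k_pos by (intro divide_pos_pos add_pos_nonneg) auto
  from minkowski_measurableI[OF this minkowski_limit]
  show "upper_box_dim ((\<lambda>t. polar (\<rho> t) (t + \<theta>0)) ` I) = 4 * real k / (2 * real k + 1)"
    and "lower_box_dim ((\<lambda>t. polar (\<rho> t) (t + \<theta>0)) ` I) = 4 * real k / (2 * real k + 1)"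
    and "minkowski_measurable ((\<lambda>t. polar (\<rho> t) (t + \<theta>0)) ` I)"
    by auto
qed

end

theorem theorem3p4:
  fixes k :: nat and a :: real
    and \<phi> :: "real \<Rightarrow> real \<times> real" and I :: "real set"
  assumes k_pos: "k \<ge> 1"
    and I_interval: "is_interval I"
    and solution: "\<forall>t\<in>I. (\<phi> has_vector_derivative hopf_inv_field k a (\<phi> t)) (at t within I)"
    and unbounded: "\<not> bounded (\<phi> ` I)"
    and away_from_origin: "\<exists>\<delta>>0. \<forall>t\<in>I. \<delta> \<le> norm (\<phi> t)"
  shows "(a = 0 \<longrightarrow>
            upper_box_dim_inf (\<phi> ` I) = 4 * real k / (2 * real k + 1) \<and>
            lower_box_dim_inf (\<phi> ` I) = 4 * real k / (2 * real k + 1) \<and>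
            minkowski_measurable_inf (\<phi> ` I))
       \<and> (a \<noteq> 0 \<longrightarrow>
            upper_box_dim_inf (\<phi> ` I) = 1 \<and> lower_box_dim_inf (\<phi> ` I) = 1)"
proof -
  obtain \<delta> where \<delta>: "\<delta> > 0" "\<forall>t\<in>I. \<delta> \<le> norm (\<phi> t)" using away_from_origin by blast
  interpret hopf_inversion_orbit k a \<phi> I \<delta>
    using k_pos I_interval solution unbounded \<delta> by unfold_locales auto
  obtain \<theta>0 where \<theta>0: "\<forall>t\<in>I. inversion (\<phi> t) = polar (\<rho> t) (t + \<theta>0)"
    using angle_linear by blast
  then have "inversion ` \<phi> ` I = (\<lambda>t. polar (\<rho> t) (t + \<theta>0)) ` I"
    by (auto simp: image_image)
  then show ?thesis
    unfolding upper_box_dim_inf_def lower_box_dim_inf_def minkowski_measurable_inf_def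
    using minkowski_weak_focus box_dim_hyperbolic by simp
qed

end
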